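(* Let $G$ be a finite simple graph on $n$ vertices, let $G_\omega^\sigma$ be a weighted oriented graph of $G$ (an orientation $G^\sigma$ of $G$ together with a real weight on each arc), and let $A_s(G_\omega^\sigma)$ be its generalized skew adjacency matrix. Write $\pi(G_\omega^\sigma,x)=\mathrm{per}(xI-A_s(G_\omega^\sigma))=\sum_{k=0}^{n}a_{k}x^{n-k}$. Then $a_k=0$ if $k$ is odd, and $$a_k=\sum_{U\in\mathcal{E}\mathscr{U}_k}(-1)^{m(U)+c^{-}(U)}\,2^{c(U)}\prod(U)\quad\text{if } k \text{ is even},$$ where $\mathcal{E}\mathscr{U}_k$ is the set of all Sachs subgraphs of $G$ on exactly $k$ vertices with no odd cycles, $m(U)$ is the number of single edges of $U$ (components of $U$ that are a single edge), $c(U)$ is the number of cycles of $U$, $c^{-}(U)$ is the number of cycles of $U$ that are oddly oriented relative to $G^\sigma$, and $\prod(U)$ is the weight product of $U$ defined in the context. In particular, $$\mathrm{per}(A_s(G_\omega^\sigma))=\sum_{U\in\mathcal{E}\mathscr{U}_n}(-1)^{m(U)+c^{-}(U)}\,2^{c(U)}\prod(U).$$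
   Context: An orientation $G^\sigma$ of a simple graph $G$ with vertex set $\{v_1,\dots,v_n\}$ assigns to each edge one of its two directions. A weighted oriented graph $G_\omega^\sigma$ is an oriented graph $G^\sigma$ with a weight function $\omega$ assigning to each arc $(v_i,v_j)$ a weight $\omega_{ij}$. Its generalized skew adjacency matrix $A_s(G_\omega^\sigma)=(a_{ij})$ is the $n\times n$ matrix with $a_{ij}=\omega_{ij}$ if $(v_i,v_j)$ is an arc, $a_{ij}=-\omega_{ji}$ if $(v_j,v_i)$ is an arc, and $a_{ij}=0$ otherwise. The permanent of $M=(m_{ij})$ is $\mathrm{per}(M)=\sum_{\pi\in S_n}\prod_{i=1}^{n}m_{i\pi(i)}$. A Sachs graph is an undirected graph in which each component is a single edge ($K_2$) or a cycle (of length at least 3). A Sachs subgraph of $G$ is a (not necessarily induced) subgraph of $G$ that is a Sachs graph; for $k=0$ the empty graph is the only one. An even cycle $C$ of $G$ is oddly (resp. evenly) oriented relative to $G^\sigma$ if, for either choice of direction of traversal around $C$, the number of edges of $C$ whose orientation agrees with the direction of traversal is odd (resp. even). For a Sachs subgraph $U$ of $G$, $\prod(U)=\prod_{e\in E(U)}(w(e))^{\zeta(e;U)}$, where $E(U)$ is the edge set of $U$, $w(e)$ is the weight of the edge $e$ (the weight $\omega_{ij}$ of the corresponding arc $(v_i,v_j)$), and $\zeta(e;U)=1$ if $e$ is contained in some cycle of $U$, and $\zeta(e;U)=2$ otherwise. (The empty product is $1$.) *)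

theory Defs
  imports "Jordan_Normal_Form.Char_Poly"
begin

text \<open>A graph is a pair of a vertex set and an edge set.\<close>

type_synonym 'a ugraph = "'a set \<times> 'a set set"

abbreviation verts :: "'a ugraph \<Rightarrow> 'a set" where
  "verts G \<equiv> fst G"

abbreviation edges :: "'a ugraph \<Rightarrow> 'a set set" where
  "edges G \<equiv> snd G"

definition finite_simple_graph :: "'a ugraph \<Rightarrow> bool" where
  "finite_simple_graph G \<longleftrightarrow> finite (verts G) \<and> (\<forall>e\<in>edges G. e \<subseteq> verts G \<and> card e = 2)"

definition subgraph_of :: "'a ugraph \<Rightarrow> 'a ugraph \<Rightarrow> bool" where
  "subgraph_of H G \<longleftrightarrow>
     verts H \<subseteq> verts G \<and> edges H \<subseteq> edges G \<and> (\<forall>e\<in>edges H. e \<subseteq> verts H)"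

definition adj_rel :: "'a ugraph \<Rightarrow> 'a rel" where
  "adj_rel G = {(u, v). {u, v} \<in> edges G}"

definition graph_components :: "'a ugraph \<Rightarrow> 'a ugraph set" where
  "graph_components G =
     (\<lambda>u. let W = {w \<in> verts G. (u, w) \<in> (adj_rel G)\<^sup>*} in (W, {e \<in> edges G. e \<subseteq> W})) ` verts G"

definition is_single_edge :: "'a ugraph \<Rightarrow> bool" where
  "is_single_edge C \<longleftrightarrow> (\<exists>u v. u \<noteq> v \<and> C = ({u, v}, {{u, v}}))"

text \<open>The list \<open>xs\<close> goes once around the cycle \<open>C\<close>, from an arbitrary starting vertex and in
  one of the two directions.\<close>

definition traverses :: "'a list \<Rightarrow> 'a ugraph \<Rightarrow> bool" where
  "traverses xs C \<longleftrightarrow> distinct xs \<and> length xs \<ge> 3 \<and>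
     C = (set xs, {{xs ! i, xs ! (Suc i mod length xs)} | i. i < length xs})"

definition is_cycle :: "'a ugraph \<Rightarrow> bool" where
  "is_cycle C \<longleftrightarrow> (\<exists>xs. traverses xs C)"

definition cycles_of :: "'a ugraph \<Rightarrow> 'a ugraph set" where
  "cycles_of G = {C. subgraph_of C G \<and> is_cycle C}"

definition sachs_graph :: "'a ugraph \<Rightarrow> bool" where
  "sachs_graph U \<longleftrightarrow> (\<forall>C\<in>graph_components U. is_single_edge C \<or> is_cycle C)"

definition even_sachs_subgraphs :: "'a ugraph \<Rightarrow> nat \<Rightarrow> 'a ugraph set" where
  "even_sachs_subgraphs G k =
     {U. subgraph_of U G \<and> sachs_graph U \<and> card (verts U) = k \<and>
         (\<forall>C\<in>cycles_of U. even (card (edges C)))}"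

text \<open>\<open>A\<close> is the arc set of an orientation of \<open>G\<close>: forgetting directions maps \<open>A\<close> bijectively
  onto the edge set.\<close>

definition orientation_of :: "'a rel \<Rightarrow> 'a ugraph \<Rightarrow> bool" where
  "orientation_of A G \<longleftrightarrow> bij_betw (\<lambda>(u, v). {u, v}) A (edges G)"

definition oddly_oriented :: "'a rel \<Rightarrow> 'a ugraph \<Rightarrow> bool" where
  "oddly_oriented A C \<longleftrightarrow>
     (\<forall>xs. traverses xs C \<longrightarrow>
        odd (card {i. i < length xs \<and> (xs ! i, xs ! (Suc i mod length xs)) \<in> A}))"

definition edge_weight :: "'a rel \<Rightarrow> ('a \<times> 'a \<Rightarrow> real) \<Rightarrow> 'a set \<Rightarrow> real" where
  "edge_weight A \<omega> e = \<omega> (THE a. a \<in> A \<and> {fst a, snd a} = e)"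

definition edge_mult :: "'a ugraph \<Rightarrow> 'a set \<Rightarrow> nat" where
  "edge_mult U e = (if \<exists>C\<in>cycles_of U. e \<in> edges C then 1 else 2)"

definition weight_product :: "'a rel \<Rightarrow> ('a \<times> 'a \<Rightarrow> real) \<Rightarrow> 'a ugraph \<Rightarrow> real" where
  "weight_product A \<omega> U = (\<Prod>e\<in>edges U. edge_weight A \<omega> e ^ edge_mult U e)"

definition num_single_edges :: "'a ugraph \<Rightarrow> nat" where
  "num_single_edges U = card {C \<in> graph_components U. is_single_edge C}"

definition num_cycles :: "'a ugraph \<Rightarrow> nat" where
  "num_cycles U = card (cycles_of U)"

definition num_odd_cycles :: "'a rel \<Rightarrow> 'a ugraph \<Rightarrow> nat" where
  "num_odd_cycles A U = card {C \<in> cycles_of U. oddly_oriented A C}"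

text \<open>\<open>v 0, \<dots>, v (n - 1)\<close> is the numbering of the vertices that indexes rows and columns.
  Values of \<open>\<omega>\<close> outside the arc set \<open>A\<close> are irrelevant.\<close>

definition skew_adj_mat ::
    "nat \<Rightarrow> (nat \<Rightarrow> 'a) \<Rightarrow> 'a rel \<Rightarrow> ('a \<times> 'a \<Rightarrow> real) \<Rightarrow> real mat" where
  "skew_adj_mat n v A \<omega> = mat n n (\<lambda>(i, j).
     if (v i, v j) \<in> A then \<omega> (v i, v j)
     else if (v j, v i) \<in> A then - \<omega> (v j, v i)
     else 0)"

text \<open>As for \<^const>\<open>det\<close>, only the value on square matrices is meaningful.\<close>

definition permanent :: "'a :: comm_ring_1 mat \<Rightarrow> 'a" where
  "permanent M =
     (\<Sum>p \<in> {p. p permutes {0..<dim_row M}}. \<Prod>i = 0..<dim_row M. M $$ (i, p i))"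

text \<open>\<^const>\<open>char_poly_matrix\<close> \<open>M\<close> is the polynomial matrix \<open>x I - M\<close>.\<close>

definition permanental_poly :: "real mat \<Rightarrow> real poly" where
  "permanental_poly M = permanent (char_poly_matrix M)"

end

theory Submission
  imports Defs "HOL-Combinatorics.Cycles"
begin

text \<open>Since the diagonal of the skew adjacency matrix vanishes, the coefficient of \<open>x\<close> to the
  power \<open>n - k\<close> is \<open>(-1)\<^sup>k\<close> times the sum, over all vertex permutations \<open>p\<close> moving exactly
  \<open>k\<close> vertices, of the products of the entries at \<open>(u, p u)\<close>, \<open>u\<close> moved. A nonzero summand
  comes from a \<open>p\<close> whose functional graph, with edges \<open>{u, p u}\<close>, is a Sachs subgraph \<open>U\<close>.
  The permutations with a given \<open>U\<close> are chosen independently on the components of \<open>U\<close>, so their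
  total is a product over components: a single edge admits only the transposition and contributes
  minus its squared weight, while a cycle admits its two rotations, whose contributions cancel for
  odd length and coincide for even length, with sign given by the orientation.\<close>

section \<open>Permutations covering a cycle\<close>

text \<open>These permutations have \<open>C\<close> as functional graph once directions and
  multiplicities are forgotten. An orbit of length two collapses to one edge; a longer orbit becomes
  a cycle.\<close>

definition covering_perms :: "'a ugraph \<Rightarrow> ('a \<Rightarrow> 'a) set" where
  "covering_perms C = {p. p permutes verts C \<and> (\<forall>u\<in>verts C. p u \<noteq> u) \<and>
     edges C = (\<lambda>u. {u, p u}) ` verts C}"

text \<open>Orbit-free form of transitivity: no proper nonempty subset is invariant.\<close>

definition transitive_perm :: "('a \<Rightarrow> 'a) \<Rightarrow> 'a set \<Rightarrow> bool" where
  "transitive_perm c W \<longleftrightarrow> c permutes W \<and> W \<noteq> {} \<and> (\<forall>X\<subseteq>W. X \<noteq> {} \<longrightarrow> c ` X \<subseteq> X \<longrightarrow> X = W)"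

lemma covering_permsD:
  assumes "p \<in> covering_perms C"
  shows "p permutes verts C" "\<And>u. u \<in> verts C \<Longrightarrow> p u \<noteq> u" "edges C = (\<lambda>u. {u, p u}) ` verts C"
  using assms by (auto simp: covering_perms_def)

text \<open>A vertex lies on an edge \<open>{w, p w}\<close> either as the source, with other end
  its image, or as the target, with other end its preimage. So the edge set determines
  \<open>p\<close> at each vertex up to direction.\<close>

lemma covering_perms_edge_iff:
  assumes "p \<in> covering_perms C" "u \<in> verts C"
  shows "{u, x} \<in> edges C \<longleftrightarrow> x = p u \<or> x = Hilbert_Choice.inv p u"
proof -
  note p = covering_permsD[OF assms(1)]
  have inv_u: "p (Hilbert_Choice.inv p u) = u" "Hilbert_Choice.inv p u \<in> verts C"
    using p(1) assms(2) by (auto simp: permutes_inverses permutes_in_image[OF permutes_inv])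
  show ?thesis
  proof
    assume "{u, x} \<in> edges C"
    then obtain w where w: "w \<in> verts C" "{u, x} = {w, p w}" using p(3) by auto
    then show "x = p u \<or> x = Hilbert_Choice.inv p u"
      using permutes_inverses[OF p(1)] by (metis doubleton_eq_iff)
  next
    assume "x = p u \<or> x = Hilbert_Choice.inv p u"
    then show "{u, x} \<in> edges C"
      using inv_u assms(2) unfolding p(3) by (metis (no_types, lifting) image_eqI insert_commute)
  qed
qed

text \<open>Reversing all arcs of the functional graph does not change the undirected edges.\<close>

lemma inv_in_covering_perms:
  assumes "p \<in> covering_perms C"
  shows "Hilbert_Choice.inv p \<in> covering_perms C"
proof -
  note p = covering_permsD[OF assms]
  have "edges C = (\<lambda>u. {u, Hilbert_Choice.inv p u}) ` p ` verts C"
    unfolding p(3) image_image using permutes_inverses(2)[OF p(1)] by (auto simp: insert_commute)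
  then have "edges C = (\<lambda>u. {u, Hilbert_Choice.inv p u}) ` verts C"
    by (simp add: permutes_image[OF p(1)])
  moreover have "\<forall>u\<in>verts C. Hilbert_Choice.inv p u \<noteq> u"
    using p(2) permutes_inverses(1)[OF p(1)] by metis
  ultimately show ?thesis
    using permutes_inv[OF p(1)] by (auto simp: covering_perms_def)
qed

text \<open>At each vertex the edges leave \<open>p\<close> only two choices, following
  \<open>c\<close> or its inverse. The set where \<open>p\<close> agrees with \<open>c\<close> is
  invariant under \<open>c\<close>, so by transitivity it is empty or everything: the choice is made
  once for the whole cycle.\<close>

lemma covering_perms_transitive:
  assumes c: "c \<in> covering_perms C" "transitive_perm c (verts C)"
    and cc: "\<And>u. u \<in> verts C \<Longrightarrow> c (c u) \<noteq> u"
  shows "covering_perms C = {c, Hilbert_Choice.inv c}"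
proof -
  note cp = covering_permsD[OF c(1)]
  note ci = permutes_inverses[OF cp(1)]
  have "p = c \<or> p = Hilbert_Choice.inv c" if p: "p \<in> covering_perms C" for p
  proof -
    note pp = covering_permsD[OF p]
    note pi = permutes_inverses[OF pp(1)]
    have dich: "p u = c u \<or> p u = Hilbert_Choice.inv c u" if "u \<in> verts C" for u
      using covering_perms_edge_iff[OF c(1) that] covering_perms_edge_iff[OF p that] by blast
    define X where "X = {u \<in> verts C. p u = c u}"
    \<comment> \<open>If \<open>p\<close> followed \<open>c\<close> at \<open>u\<close> but turned
      back at \<open>c u\<close>, then \<open>c u\<close> would be both image and preimage of
      \<open>u\<close> under \<open>p\<close>. The two neighbours of \<open>u\<close> would
      coincide, against \<open>cc\<close>.\<close>
    have "c u \<in> X" if "u \<in> X" for u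
    proof (rule ccontr)
      have u: "u \<in> verts C" "p u = c u" using that by (auto simp: X_def)
      have cu: "c u \<in> verts C" using u(1) permutes_in_image[OF cp(1)] by simp
      assume "c u \<notin> X"
      then have pcu: "p (c u) = u" using dich[OF cu] cu ci by (auto simp: X_def)
      have "{u, Hilbert_Choice.inv c u} \<in> edges C" using covering_perms_edge_iff[OF c(1) u(1)] by simp
      then have "Hilbert_Choice.inv c u = p u \<or> Hilbert_Choice.inv c u = Hilbert_Choice.inv p u"
        using covering_perms_edge_iff[OF p u(1)] by simp
      then have "Hilbert_Choice.inv c u = c u" using u(2) pcu pi by metis
      then have "c (c u) = u" using ci by metis
      then show False using cc u(1) by blast
    qed
    then have "c ` X \<subseteq> X" by blast
    moreover have "X \<subseteq> verts C" by (auto simp: X_def)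
    ultimately have "X = {} \<or> X = verts C" using c(2) by (auto simp: transitive_perm_def)
    then show ?thesis
    proof
      assume "X = {}"
      then have "p u = Hilbert_Choice.inv c u" for u
        using dich permutes_not_in[OF pp(1)] permutes_not_in[OF permutes_inv[OF cp(1)]]
        by (cases "u \<in> verts C") (auto simp: X_def)
      then show ?thesis by auto
    next
      assume "X = verts C"
      then have "p u = c u" for u
        using permutes_not_in[OF pp(1)] permutes_not_in[OF cp(1)]
        by (cases "u \<in> verts C") (auto simp: X_def)
      then show ?thesis by auto
    qed
  qed
  then show ?thesis using c inv_in_covering_perms by blast
qed

section \<open>Cycles as lists and as transitive permutations\<close>

lemma cycle_of_list_nth:
  assumes "distinct xs" "i < length xs"
  shows "cycle_of_list xs (xs ! i) = xs ! (Suc i mod length xs)"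
proof -
  have "map (cycle_of_list xs) xs = rotate 1 xs"
    using cyclic_rotation[OF assms(1), of 1] by simp
  then have "cycle_of_list xs (xs ! i) = rotate 1 xs ! i"
    using assms(2) by (metis nth_map)
  then show ?thesis using assms(2) nth_rotate[of i xs 1] by simp
qed

lemma traverses_verts: "traverses xs C \<Longrightarrow> verts C = set xs"
  by (auto simp: traverses_def)

text \<open>Sending each listed vertex to its successor turns a traversal into a permutation. Length
  at least three excludes returns after one or two steps, and iterating from any vertex reaches all
  others.\<close>

lemma traverses_covering_perm:
  assumes "traverses xs C"
  shows "cycle_of_list xs \<in> covering_perms C" "transitive_perm (cycle_of_list xs) (verts C)"
    "\<And>u. u \<in> verts C \<Longrightarrow> cycle_of_list xs (cycle_of_list xs u) \<noteq> u"
proof -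
  define m where "m = length xs"
  define c where "c = cycle_of_list xs"
  have d: "distinct xs" and m3: "m \<ge> 3" and
    C: "verts C = set xs" "edges C = {{xs ! i, xs ! (Suc i mod m)} | i. i < m}"
    using assms by (auto simp: traverses_def m_def)
  have cn: "c (xs ! i) = xs ! (Suc i mod m)" if "i < m" for i
    using cycle_of_list_nth[OF d] that by (simp add: c_def m_def)
  have perm: "c permutes set xs" unfolding c_def by (rule cycle_permutes)
  have neq: "c u \<noteq> u" "c (c u) \<noteq> u" if u: "u \<in> set xs" for u
  proof -
    obtain i where i: "i < m" "u = xs ! i" using u by (auto simp: in_set_conv_nth m_def)
    have j: "Suc i mod m < m" "Suc (Suc i mod m) mod m < m" using m3 by auto
    have "Suc i mod m \<noteq> i" "Suc (Suc i mod m) mod m \<noteq> i"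
      using i(1) m3 by (auto simp: mod_Suc)
    then show "c u \<noteq> u" "c (c u) \<noteq> u"
      using cn[OF i(1)] cn[OF j(1)] i j d by (auto simp: nth_eq_iff_index_eq m_def)
  qed
  have "edges C = (\<lambda>u. {u, c u}) ` set xs"
    unfolding C(2)
  proof (intro equalityI subsetI)
    fix e assume "e \<in> (\<lambda>u. {u, c u}) ` set xs"
    then obtain i where "i < m" "e = {xs ! i, c (xs ! i)}" by (auto simp: in_set_conv_nth m_def)
    then show "e \<in> {{xs ! i, xs ! (Suc i mod m)} | i. i < m}" using cn by auto
  qed (use cn in \<open>force simp: m_def\<close>)
  then show "cycle_of_list xs \<in> covering_perms C"
    using perm neq(1) C(1) by (auto simp: covering_perms_def c_def)
  show "\<And>u. u \<in> verts C \<Longrightarrow> cycle_of_list xs (cycle_of_list xs u) \<noteq> u"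
    using neq(2) C(1) by (auto simp: c_def)
  have "X = set xs" if X: "X \<subseteq> set xs" "X \<noteq> {}" "c ` X \<subseteq> X" for X
  proof -
    obtain y where y: "y \<in> X" using X(2) by blast
    then have "y \<in> set xs" using X(1) by blast
    then obtain i where i: "i < m" "xs ! i \<in> X"
      using y by (auto simp: in_set_conv_nth m_def)
    have *: "xs ! ((i + k) mod m) \<in> X" for k
    proof (induction k)
      case 0
      then show ?case using i by simp
    next
      case (Suc k)
      then have "c (xs ! ((i + k) mod m)) \<in> X" using X(3) by blast
      then show ?case using cn[of "(i + k) mod m"] m3 by (simp add: mod_Suc_eq)
    qed
    \<comment> \<open>From index \<open>i\<close>, going \<open>j + m - i\<close> steps leads to
      index \<open>j\<close>; the summand \<open>m\<close> keeps the subtraction from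
      truncating.\<close>
    have "xs ! j \<in> X" if "j < m" for j
      using *[of "j + m - i"] i(1) that by simp
    then show ?thesis using X(1) by (auto simp: in_set_conv_nth m_def)
  qed
  then show "transitive_perm (cycle_of_list xs) (verts C)"
    using perm C(1) m3 by (auto simp: transitive_perm_def c_def m_def)
qed

text \<open>The iterates of \<open>c\<close> at one vertex form an invariant set, which by
  transitivity is the whole vertex set; listed in order they are a traversal. Its length is neither
  1 nor 2, since no vertex returns after one or two steps.\<close>

lemma is_cycle_covering_perm:
  assumes fin: "finite (verts C)" and c: "c \<in> covering_perms C" "transitive_perm c (verts C)"
    and cc: "\<And>u. u \<in> verts C \<Longrightarrow> c (c u) \<noteq> u"
  shows "is_cycle C"
proof -
  note cp = covering_permsD[OF c(1)]
  obtain x where x: "x \<in> verts C" using c(2) by (auto simp: transitive_perm_def)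
  have perm: "permutation c" using cp(1) fin by (auto simp: permutation_permutes)
  define m where "m = least_power c x"
  define xs where "xs = support c x"
  have len: "length xs = m" by (simp add: xs_def m_def)
  have nth: "xs ! i = (c ^^ i) x" if "i < m" for i using that by (simp add: xs_def m_def)
  have lp: "(c ^^ m) x = x" "m > 0"
    using least_power_of_permutation[OF perm, of x] by (auto simp: m_def)
  have d: "distinct xs" unfolding xs_def by (rule cycle_of_permutation[OF perm])
  have cn: "c (xs ! i) = xs ! (Suc i mod m)" if "i < m" for i
  proof (cases "Suc i = m")
    case True
    then have "c (xs ! i) = (c ^^ m) x" using nth[OF that] by auto
    then show ?thesis using True lp nth[of 0] by simp
  next
    case False
    then show ?thesis using nth[OF that] nth[of "Suc i"] that by simp
  qed
  have "m \<noteq> 1" "m \<noteq> 2" using lp(1) cp(2)[OF x] cc[OF x] by (auto simp: numeral_2_eq_2)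
  then have m3: "m \<ge> 3" using lp(2) by linarith
  have "(c ^^ i) x \<in> verts C" for i
    using x permutes_in_image[OF permutes_funpow[OF cp(1)]] by simp
  then have "set xs \<subseteq> verts C" by (auto simp: xs_def)
  moreover have "c ` set xs \<subseteq> set xs"
  proof
    fix y assume "y \<in> c ` set xs"
    then obtain i where "i < m" "y = c (xs ! i)" using len by (auto simp: in_set_conv_nth)
    then show "y \<in> set xs" using cn len m3 by (auto intro!: nth_mem)
  qed
  moreover have "set xs \<noteq> {}" using len m3 by auto
  ultimately have V: "set xs = verts C" using c(2) unfolding transitive_perm_def by blast
  have "edges C = {{xs ! i, c (xs ! i)} | i. i < m}"
    unfolding cp(3) V[symmetric] len[symmetric] by (auto simp: set_conv_nth)
  also have "\<dots> = {{xs ! i, xs ! (Suc i mod m)} | i. i < m}"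
    by (intro Collect_cong ex_cong1) (use cn in auto)
  finally have "edges C = {{xs ! i, xs ! (Suc i mod m)} | i. i < m}" .
  then have "traverses xs C"
    using V d m3 len by (cases C) (auto simp: traverses_def)
  then show ?thesis by (auto simp: is_cycle_def)
qed

lemma is_cycleE:
  assumes "is_cycle C"
  obtains c where "c \<in> covering_perms C" "transitive_perm c (verts C)"
    "\<And>u. u \<in> verts C \<Longrightarrow> c (c u) \<noteq> u"
proof -
  obtain xs where "traverses xs C" using assms by (auto simp: is_cycle_def)
  from that[OF traverses_covering_perm[OF this]] show thesis .
qed

lemma is_cycle_card:
  assumes "is_cycle C"
  shows "finite (verts C)" "card (verts C) \<ge> 3"
proof -
  obtain xs where xs: "traverses xs C"
    using assms unfolding is_cycle_def by blast
  then have "distinct xs" "length xs \<ge> 3"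
    unfolding traverses_def by blast+
  then show "finite (verts C)" "card (verts C) \<ge> 3"
    by (simp_all add: traverses_verts[OF xs] distinct_card)
qed

lemma is_single_edge_not_cycle: "is_single_edge C \<Longrightarrow> \<not> is_cycle C"
  using is_cycle_card(2)[of C] by (auto simp: is_single_edge_def)

lemma single_edge_covering_perms:
  assumes "u \<noteq> w"
  shows "covering_perms ({u, w}, {{u, w}}) = {transpose u w}"
proof (intro equalityI subsetI)
  fix p assume "p \<in> covering_perms ({u, w}, {{u, w}})"
  note p = covering_permsD[OF this, simplified]
  have "p u = w" "p w = u" using p(1,2) assms permutes_in_image[OF p(1)] by auto
  then have "p = transpose u w"
    using permutes_not_in[OF p(1)] by (auto simp: transpose_def)
  then show "p \<in> {transpose u w}" by simp
next
  fix p assume "p \<in> {transpose u w}"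
  then show "p \<in> covering_perms ({u, w}, {{u, w}})"
    using assms by (auto simp: covering_perms_def permutes_swap_id insert_commute)
qed

section \<open>Components of a graph\<close>

text \<open>Gives a name to the function mapped over the vertices in
  \<open>graph_components\<close>, so that the component of a given vertex can be addressed.\<close>

definition component :: "'a ugraph \<Rightarrow> 'a \<Rightarrow> 'a ugraph" where
  "component U u = (let W = {w \<in> verts U. (u, w) \<in> (adj_rel U)\<^sup>*} in (W, {e \<in> edges U. e \<subseteq> W}))"

lemma graph_components_eq: "graph_components U = component U ` verts U"
  by (simp add: graph_components_def component_def)

lemma verts_component: "verts (component U u) = {w \<in> verts U. (u, w) \<in> (adj_rel U)\<^sup>*}"
  and edges_component: "edges (component U u) = {e \<in> edges U. e \<subseteq> verts (component U u)}"
  by (simp_all add: component_def Let_def)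

lemma adj_rtrancl_sym: "(x, y) \<in> (adj_rel U)\<^sup>* \<Longrightarrow> (y, x) \<in> (adj_rel U)\<^sup>*"
  by (rule symD[OF sym_rtrancl]) (auto simp: sym_def adj_rel_def insert_commute)

lemma component_eqI:
  assumes "w \<in> verts (component U u)"
  shows "component U w = component U u"
proof -
  have "(u, w) \<in> (adj_rel U)\<^sup>*" using assms by (simp add: verts_component)
  then have "(w, x) \<in> (adj_rel U)\<^sup>* \<longleftrightarrow> (u, x) \<in> (adj_rel U)\<^sup>*" for x
    using adj_rtrancl_sym rtrancl_trans by metis
  then show ?thesis by (simp add: component_def)
qed

lemma in_component_self: "u \<in> verts U \<Longrightarrow> u \<in> verts (component U u)"
  by (simp add: verts_component)

lemma finite_simple_graphD:
  assumes "finite_simple_graph U"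
  shows "finite (verts U)" "\<And>e. e \<in> edges U \<Longrightarrow> e \<subseteq> verts U" "\<And>e. e \<in> edges U \<Longrightarrow> card e = 2"
    "finite (edges U)"
proof -
  show *: "finite (verts U)" "\<And>e. e \<in> edges U \<Longrightarrow> e \<subseteq> verts U" "\<And>e. e \<in> edges U \<Longrightarrow> card e = 2"
    using assms by (auto simp: finite_simple_graph_def)
  then have "edges U \<subseteq> Pow (verts U)" by blast
  then show "finite (edges U)" using *(1) finite_subset by blast
qed

lemma component_closed:
  assumes "finite_simple_graph U" "{x, y} \<in> edges U" "x \<in> verts (component U u)"
  shows "y \<in> verts (component U u)"
proof -
  have "(x, y) \<in> adj_rel U" "y \<in> verts U"
    using finite_simple_graphD(2)[OF assms(1,2)] assms(2) by (auto simp: adj_rel_def)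
  then show ?thesis using assms(3) by (auto simp: verts_component)
qed

text \<open>Induction along a path from \<open>x\<close>. This is how connectedness of a component
  is later turned into transitivity of a permutation.\<close>

lemma component_subset:
  assumes "x \<in> X" "\<And>y z. y \<in> X \<Longrightarrow> {y, z} \<in> edges U \<Longrightarrow> z \<in> X"
  shows "verts (component U x) \<subseteq> X"
proof
  fix w assume "w \<in> verts (component U x)"
  then have "(x, w) \<in> (adj_rel U)\<^sup>*" by (simp add: verts_component)
  then show "w \<in> X" by (induction rule: rtrancl_induct) (use assms in \<open>auto simp: adj_rel_def\<close>)
qed

lemma component_of_graph_component:
  assumes "C \<in> graph_components U" "u \<in> verts C"
  shows "component U u = C" "u \<in> verts U"
proof -
  obtain x where x: "C = component U x" using assms(1) by (auto simp: graph_components_eq)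
  then show "component U u = C" using component_eqI assms(2) by metis
  show "u \<in> verts U" using assms(2) by (simp add: x verts_component)
qed

lemma component_in_graph_components: "u \<in> verts U \<Longrightarrow> component U u \<in> graph_components U"
  by (simp add: graph_components_eq)

lemma graph_component_verts_subset: "C \<in> graph_components U \<Longrightarrow> verts C \<subseteq> verts U"
  by (rule subsetI) (rule component_of_graph_component(2))

lemma graph_component_verts_nonempty: "C \<in> graph_components U \<Longrightarrow> verts C \<noteq> {}"
  by (auto simp: graph_components_eq dest: in_component_self)

lemma graph_component_edges: "C \<in> graph_components U \<Longrightarrow> edges C = {e \<in> edges U. e \<subseteq> verts C}"
  by (auto simp: graph_components_eq edges_component)

lemma verts_eq_Union_components: "verts U = (\<Union>C\<in>graph_components U. verts C)"
  by (auto simp: graph_components_eq intro: in_component_self)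
    (simp add: verts_component)

lemma components_verts_disjoint:
  assumes "C \<in> graph_components U" "D \<in> graph_components U" "C \<noteq> D"
  shows "verts C \<inter> verts D = {}"
  using component_of_graph_component(1)[OF assms(1)] component_of_graph_component(1)[OF assms(2)]
    assms(3) by blast

lemma finite_graph_components: "finite (verts U) \<Longrightarrow> finite (graph_components U)"
  by (simp add: graph_components_eq)

lemma finite_simple_graph_edgeE:
  assumes "finite_simple_graph U" "e \<in> edges U"
  obtains x y where "e = {x, y}" "x \<noteq> y" "x \<in> verts U" "y \<in> verts U"
proof -
  obtain x y where "e = {x, y}" "x \<noteq> y"
    using finite_simple_graphD(3)[OF assms] by (auto simp: card_2_iff)
  then show thesis using finite_simple_graphD(2)[OF assms] that by blast
qed

lemma edges_eq_Union_components:
  assumes "finite_simple_graph U"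
  shows "edges U = (\<Union>C\<in>graph_components U. edges C)"
proof (intro equalityI subsetI)
  fix e assume e: "e \<in> edges U"
  obtain x y where xy: "e = {x, y}" "x \<in> verts U"
    using finite_simple_graph_edgeE[OF assms e] by blast
  have "y \<in> verts (component U x)"
    using component_closed[OF assms] e xy(1)
      in_component_self[OF xy(2)] by metis
  then have "e \<in> edges (component U x)"
    using e xy in_component_self[OF xy(2)] by (simp add: edges_component)
  then show "e \<in> (\<Union>C\<in>graph_components U. edges C)"
    using component_in_graph_components[OF xy(2)] by blast
qed (auto simp: graph_component_edges)

text \<open>Edges have two ends, hence are nonempty, so a common edge would give a common
  vertex.\<close>

lemma components_edges_disjoint:
  assumes "finite_simple_graph U" "C \<in> graph_components U" "D \<in> graph_components U" "C \<noteq> D"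
  shows "edges C \<inter> edges D = {}"
proof (rule ccontr)
  assume "edges C \<inter> edges D \<noteq> {}"
  then obtain e where e: "e \<in> edges U" "e \<subseteq> verts C" "e \<subseteq> verts D"
    using assms(2,3) by (auto simp: graph_component_edges)
  then have "e \<noteq> {}" using finite_simple_graphD(3)[OF assms(1)] by fastforce
  then show False using e(2,3) components_verts_disjoint[OF assms(2-4)] by blast
qed

lemma finite_simple_graph_component:
  assumes "finite_simple_graph U" "C \<in> graph_components U"
  shows "finite_simple_graph C"
proof -
  have "finite (verts C)"
    using graph_component_verts_subset[OF assms(2)] finite_simple_graphD(1)[OF assms(1)]
    by (rule finite_subset)
  then show ?thesis
    using finite_simple_graphD(3)[OF assms(1)] graph_component_edges[OF assms(2)]
    by (simp add: finite_simple_graph_def)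
qed

section \<open>Restricting covering permutations to components and gluing them back\<close>

definition perm_on :: "('a \<Rightarrow> 'a) \<Rightarrow> 'a set \<Rightarrow> 'a \<Rightarrow> 'a" where
  "perm_on p W u = (if u \<in> W then p u else u)"

text \<open>Every arc \<open>(u, p u)\<close> runs along an edge, so \<open>p\<close> does not leave
  a component; on a finite set the injective restriction is then a bijection.\<close>

lemma perm_on_covering:
  assumes U: "finite_simple_graph U" and p: "p \<in> covering_perms U" and C: "C \<in> graph_components U"
  shows "perm_on p (verts C) \<in> covering_perms C"
proof -
  note pp = covering_permsD[OF p] and UD = finite_simple_graphD[OF U]
  note sub = graph_component_verts_subset[OF C]
  have closed: "p u \<in> verts C" if "u \<in> verts C" for u
  proof -
    have "{u, p u} \<in> edges U" using that sub pp(3) by auto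
    then have "p u \<in> verts (component U u)"
      by (rule component_closed[OF U _ in_component_self]) (use that sub in auto)
    then show ?thesis using component_of_graph_component[OF C that] by simp
  qed
  have inj: "inj_on p (verts C)" using permutes_inj_on[OF pp(1)] .
  have "p ` verts C = verts C"
    using endo_inj_surj[OF finite_subset[OF sub UD(1)]] closed inj by blast
  then have "bij_betw p (verts C) (verts C)" using inj by (simp add: bij_betw_def)
  then have "bij_betw (perm_on p (verts C)) (verts C) (verts C)"
    by (rule bij_betw_cong[THEN iffD1, rotated]) (simp add: perm_on_def)
  \<comment> \<open>\<open>perm_on\<close> is the identity outside \<open>verts C\<close>, as
    \<open>permutes\<close> demands.\<close>
  then have "perm_on p (verts C) permutes verts C"
    by (rule bij_imp_permutes) (simp add: perm_on_def)
  moreover have "edges C = (\<lambda>u. {u, perm_on p (verts C) u}) ` verts C"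
    unfolding graph_component_edges[OF C] pp(3) using closed sub by (auto simp: perm_on_def image_iff)
  ultimately show ?thesis using pp(2) sub by (auto simp: covering_perms_def perm_on_def)
qed

text \<open>Each vertex is moved by the permutation chosen for its own component and stays there.
  Two vertices with equal images thus share a component, where injectivity is known.\<close>

lemma glue_covering:
  assumes U: "finite_simple_graph U" and g: "\<And>C. C \<in> graph_components U \<Longrightarrow> g C \<in> covering_perms C"
  shows "perm_on (\<lambda>u. g (component U u) u) (verts U) \<in> covering_perms U"
proof -
  let ?h = "\<lambda>u. g (component U u) u"
  have h_in: "?h u \<in> verts (component U u)" if "u \<in> verts U" for u
    using permutes_in_image[OF covering_permsD(1)[OF g]] in_component_self[OF that]
      component_in_graph_components[OF that] by blast
  then have "?h ` verts U \<subseteq> verts U" by (auto simp: verts_component)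
  moreover have inj: "inj_on ?h (verts U)"
  proof (rule inj_onI)
    fix u w assume uw: "u \<in> verts U" "w \<in> verts U" "?h u = ?h w"
    then have "component U u = component U w"
      using h_in component_eqI by metis
    then show "u = w"
      using uw(3) permutes_inj[OF covering_permsD(1)[OF g[OF component_in_graph_components[OF uw(1)]]]]
      by (auto dest: injD)
  qed
  ultimately have "?h ` verts U = verts U"
    using endo_inj_surj[OF finite_simple_graphD(1)[OF U]] by blast
  then have "bij_betw ?h (verts U) (verts U)" using inj by (simp add: bij_betw_def)
  then have "bij_betw (perm_on ?h (verts U)) (verts U) (verts U)"
    by (rule bij_betw_cong[THEN iffD1, rotated]) (simp add: perm_on_def)
  then have "perm_on ?h (verts U) permutes verts U"
    by (rule bij_imp_permutes) (simp add: perm_on_def)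
  moreover have "edges U = (\<lambda>u. {u, ?h u}) ` verts U"
  proof -
    have "edges C = (\<lambda>u. {u, ?h u}) ` verts C" if "C \<in> graph_components U" for C
      unfolding covering_permsD(3)[OF g[OF that]]
      by (rule image_cong) (simp_all add: component_of_graph_component[OF that])
    then have "edges U = (\<Union>C\<in>graph_components U. (\<lambda>u. {u, ?h u}) ` verts C)"
      by (simp add: edges_eq_Union_components[OF U])
    also have "\<dots> = (\<lambda>u. {u, ?h u}) ` verts U"
      by (subst verts_eq_Union_components) (simp only: image_UN)
    finally show ?thesis .
  qed
  then have "edges U = (\<lambda>u. {u, perm_on ?h (verts U) u}) ` verts U"
    by (simp add: perm_on_def)
  moreover have "perm_on ?h (verts U) u \<noteq> u" if "u \<in> verts U" for u
    using covering_permsD(2)[OF g[OF component_in_graph_components[OF that]]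
      in_component_self[OF that]] that by (simp add: perm_on_def)
  ultimately show ?thesis by (auto simp: covering_perms_def)
qed

lemma finite_covering_perms: "finite (verts U) \<Longrightarrow> finite (covering_perms U)"
  by (rule finite_subset[OF _ finite_permutations[of "verts U"]]) (auto simp: covering_perms_def)

text \<open>With \<open>s\<close> as matrix entries, this collects those terms of the permanent on
  the rows and columns in \<open>verts U\<close> whose permutation has functional graph
  \<open>U\<close>.\<close>

definition covering_sum :: "('a \<Rightarrow> 'a \<Rightarrow> 'b :: comm_semiring_1) \<Rightarrow> 'a ugraph \<Rightarrow> 'b" where
  "covering_sum s U = (\<Sum>p\<in>covering_perms U. \<Prod>u\<in>verts U. s u (p u))"

text \<open>Restriction and gluing are mutually inverse between covering permutations of
  \<open>U\<close> and families of covering permutations of its components. The product over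
  vertices splits along components, and distributivity turns the sum over families into a product of
  sums.\<close>

lemma covering_sum_components:
  assumes U: "finite_simple_graph U"
  shows "covering_sum s U = (\<Prod>C\<in>graph_components U. covering_sum s C)"
proof -
  let ?K = "graph_components U"
  note UD = finite_simple_graphD[OF U]
  have finK: "finite ?K" using UD(1) by (rule finite_graph_components)
  have finC: "finite (verts C)" if "C \<in> ?K" for C
    using finite_simple_graph_component[OF U that] finite_simple_graphD(1) by blast
  have split: "(\<Prod>u\<in>verts U. f u) = (\<Prod>C\<in>?K. \<Prod>u\<in>verts C. f u)" for f :: "'a \<Rightarrow> 'b"
    by (subst verts_eq_Union_components, rule prod.UNION_disjoint)
      (use finK finC components_verts_disjoint in blast)+
  have "covering_sum s U =
      (\<Sum>g\<in>PiE ?K covering_perms. \<Prod>C\<in>?K. \<Prod>u\<in>verts C. s u (g C u))"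
    unfolding covering_sum_def
  proof (rule sum.reindex_bij_witness[where
        i = "\<lambda>g. perm_on (\<lambda>u. g (component U u) u) (verts U)" and
        j = "\<lambda>p. \<lambda>C\<in>?K. perm_on p (verts C)"], goal_cases)
    case (1 p)
    have "p permutes verts U" using 1 covering_permsD(1) by blast
    then show ?case
      by (auto simp: fun_eq_iff perm_on_def permutes_not_in in_component_self
          component_in_graph_components)
  next
    case (2 p)
    then show ?case using perm_on_covering[OF U] by auto
  next
    case (3 g)
    show ?case
    proof (rule PiE_ext[OF _ 3])
      show "(\<lambda>C\<in>?K. perm_on (perm_on (\<lambda>u. g (component U u) u) (verts U)) (verts C))
          \<in> PiE ?K covering_perms"
        using perm_on_covering[OF U glue_covering[OF U]] 3 by auto
      fix C assume C: "C \<in> ?K"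
      have gC: "g C \<in> covering_perms C" using 3 C by auto
      have "g C u = u" if "u \<notin> verts C" for u
        using that by (rule permutes_not_in[OF covering_permsD(1)[OF gC]])
      then have "perm_on (perm_on (\<lambda>u. g (component U u) u) (verts U)) (verts C) u = g C u" for u
        using component_of_graph_component[OF C, of u] by (auto simp: perm_on_def)
      then show "(\<lambda>C\<in>?K. perm_on (perm_on (\<lambda>u. g (component U u) u) (verts U)) (verts C)) C = g C"
        using C by auto
    qed
  next
    case (4 g)
    then show ?case using glue_covering[OF U] by auto
  next
    case (5 p)
    show ?case unfolding split by (intro prod.cong) (auto simp: perm_on_def)
  qed
  also have "\<dots> = (\<Prod>C\<in>?K. covering_sum s C)"
    unfolding covering_sum_def
    by (rule prod_sum_PiE[symmetric]) (use finK finC finite_covering_perms in auto)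
  finally show ?thesis .
qed

section \<open>Sachs graphs\<close>

text \<open>On a component the restricted permutation \<open>q\<close> is transitive, because a
  \<open>q\<close>-invariant set is closed under adjacency. If some vertex returns after two steps,
  the component is that pair; otherwise it is a cycle.\<close>

lemma covering_perms_sachs:
  assumes U: "finite_simple_graph U" and p: "p \<in> covering_perms U"
  shows "sachs_graph U"
  unfolding sachs_graph_def
proof
  fix C assume C: "C \<in> graph_components U"
  define q where "q = perm_on p (verts C)"
  have q: "q \<in> covering_perms C" unfolding q_def by (rule perm_on_covering[OF U p C])
  note qp = covering_permsD[OF q]
  have finC: "finite (verts C)"
    using finite_simple_graphD(1)[OF finite_simple_graph_component[OF U C]] .
  have trans: "transitive_perm q (verts C)"
    unfolding transitive_perm_def
  proof (intro conjI allI impI)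
    fix X assume X: "X \<subseteq> verts C" "X \<noteq> {}" "q ` X \<subseteq> X"
    have "inj_on q X" using permutes_inj_on[OF qp(1)] .
    \<comment> \<open>On a finite set forward invariance gives backward invariance, which takes care
      of the neighbour reached through the inverse of \<open>q\<close>.\<close>
    then have qX: "q ` X = X" using endo_inj_surj[OF finite_subset[OF X(1) finC] X(3)] by blast
    obtain x where x: "x \<in> X" using X(2) by blast
    then have Cx: "component U x = C" using component_of_graph_component(1)[OF C] X(1) by blast
    have "z \<in> X" if yz: "y \<in> X" "{y, z} \<in> edges U" for y z
    proof -
      have y: "y \<in> verts C" using yz(1) X(1) by blast
      then have "z \<in> verts C" using component_closed[OF U yz(2), of x] Cx by simp
      then have "{y, z} \<in> edges C" using graph_component_edges[OF C] y yz(2) by simp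
      then have "z = q y \<or> z = Hilbert_Choice.inv q y"
        using covering_perms_edge_iff[OF q y] by blast
      moreover have "q y \<in> X" using X(3) yz(1) by blast
      moreover have "Hilbert_Choice.inv q y \<in> X"
      proof -
        have "y \<in> q ` X" using qX yz(1) by simp
        then obtain w where "w \<in> X" "y = q w" by blast
        then show ?thesis using permutes_inverses(2)[OF qp(1)] by simp
      qed
      ultimately show ?thesis by blast
    qed
    then have "verts (component U x) \<subseteq> X" using component_subset[of x X U] x by blast
    then show "X = verts C" using Cx X(1) by blast
  qed (use qp(1) graph_component_verts_nonempty[OF C] in auto)
  show "is_single_edge C \<or> is_cycle C"
  proof (cases "\<exists>u\<in>verts C. q (q u) = u")
    case True
    then obtain u where u: "u \<in> verts C" "q (q u) = u" by blast
    have "q u \<in> verts C" using u(1) by (simp add: permutes_in_image[OF qp(1)])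
    then have "{u, q u} \<subseteq> verts C" "q ` {u, q u} \<subseteq> {u, q u}" using u by auto
    then have V: "verts C = {u, q u}" using trans unfolding transitive_perm_def by blast
    have "edges C = {{u, q u}}" unfolding qp(3) V using u(2) by (simp add: insert_commute)
    then have "C = ({u, q u}, {{u, q u}})" using V by (simp add: prod_eq_iff)
    then show ?thesis using qp(2)[OF u(1)] unfolding is_single_edge_def by metis
  next
    case False
    then show ?thesis using is_cycle_covering_perm[OF finC q trans] by blast
  qed
qed

text \<open>A vertex has exactly two neighbours in either cycle, so at a vertex of \<open>C\<close>
  the neighbours in \<open>D\<close> are those in \<open>C\<close>. Hence \<open>verts C\<close> is
  invariant under the transitive permutation \<open>d\<close> and exhausts
  \<open>verts D\<close>.\<close>

lemma cycle_subgraph_of_cycle: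
  assumes C: "is_cycle C" and D: "is_cycle D" and sub: "verts C \<subseteq> verts D" "edges C \<subseteq> edges D"
  shows "C = D"
proof -
  obtain c where c: "c \<in> covering_perms C" "transitive_perm c (verts C)"
    and cc: "\<And>u. u \<in> verts C \<Longrightarrow> c (c u) \<noteq> u"
    using is_cycleE[OF C] by blast
  obtain d where d: "d \<in> covering_perms D" "transitive_perm d (verts D)"
    using is_cycleE[OF D] by blast
  note ci = permutes_inverses[OF covering_permsD(1)[OF c(1)]]
  have nbr: "d u = c u \<or> d u = Hilbert_Choice.inv c u" if u: "u \<in> verts C" for u
  proof -
    have "{u, c u} \<in> edges D" "{u, Hilbert_Choice.inv c u} \<in> edges D"
      using covering_perms_edge_iff[OF c(1) u] sub(2) by blast+
    then have "c u \<in> {d u, Hilbert_Choice.inv d u}"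
      "Hilbert_Choice.inv c u \<in> {d u, Hilbert_Choice.inv d u}"
      using covering_perms_edge_iff[OF d(1)] u sub(1) by blast+
    moreover have "c u \<noteq> Hilbert_Choice.inv c u" using cc[OF u] ci by metis
    ultimately show ?thesis by auto
  qed
  have in_C: "c u \<in> verts C" "Hilbert_Choice.inv c u \<in> verts C" if "u \<in> verts C" for u
    using that covering_permsD(1)[OF c(1)] by (simp_all add: permutes_in_image[of _ "verts C"] permutes_inv)
  have "d u \<in> verts C" if "u \<in> verts C" for u
    using nbr[OF that] in_C[OF that] by auto
  then have "d ` verts C \<subseteq> verts C" by auto
  moreover have "verts C \<noteq> {}" using c(2) by (simp add: transitive_perm_def)
  ultimately have V: "verts C = verts D"
    using d(2) sub(1) unfolding transitive_perm_def by blast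
  have "{u, d u} \<in> edges C" if "u \<in> verts C" for u
    using nbr[OF that] covering_perms_edge_iff[OF c(1) that] by blast
  then have "edges D \<subseteq> edges C" using V by (auto simp: covering_permsD(3)[OF d(1)])
  then show ?thesis using V sub(2) by (simp add: prod_eq_iff)
qed

text \<open>\<open>cycles_of\<close> admits arbitrary subgraphs. A cycle is connected, so it lies
  inside one component; that component has at least three vertices, is therefore a cycle itself, and
  a cycle contains no smaller one.\<close>

lemma cycles_of_sachs_graph:
  assumes U: "finite_simple_graph U" and sachs: "sachs_graph U"
  shows "cycles_of U = {C \<in> graph_components U. is_cycle C}"
proof (intro equalityI subsetI)
  fix C assume "C \<in> {C \<in> graph_components U. is_cycle C}"
  then show "C \<in> cycles_of U"
    using graph_component_edges[of C U] graph_component_verts_subset[of C U]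
    by (auto simp: cycles_of_def subgraph_of_def)
next
  fix C assume "C \<in> cycles_of U"
  then have sub: "verts C \<subseteq> verts U" "edges C \<subseteq> edges U" and cyc: "is_cycle C"
    by (auto simp: cycles_of_def subgraph_of_def)
  obtain c where c: "c \<in> covering_perms C" "transitive_perm c (verts C)"
    using is_cycleE[OF cyc] by blast
  note cp = covering_permsD[OF c(1)]
  obtain u where u: "u \<in> verts C" using c(2) by (auto simp: transitive_perm_def)
  define D where "D = component U u"
  have D: "D \<in> graph_components U" "u \<in> verts D"
    using u sub(1) in_component_self[of u U] component_in_graph_components[of u U]
    by (auto simp: D_def)
  \<comment> \<open>Connectedness of \<open>C\<close> enters as transitivity of \<open>c\<close>:
    the set \<open>X\<close> contains \<open>u\<close> and is invariant under \<open>c\<close>, so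
    it is all of \<open>verts C\<close>.\<close>
  define X where "X = verts C \<inter> verts D"
  have "c x \<in> X" if "x \<in> X" for x
  proof -
    have "{x, c x} \<in> edges U" using that cp(3) sub(2) by (auto simp: X_def)
    then have "c x \<in> verts D"
      using component_closed[OF U, of x "c x" u] that by (simp add: X_def D_def)
    then show ?thesis using that permutes_in_image[OF cp(1)] by (simp add: X_def)
  qed
  then have "c ` X \<subseteq> X" "X \<subseteq> verts C" "X \<noteq> {}" using u D(2) by (auto simp: X_def)
  then have "X = verts C"
    using c(2) unfolding transitive_perm_def by blast
  then have VD: "verts C \<subseteq> verts D" by (auto simp: X_def)
  have "e \<subseteq> verts C" if "e \<in> edges C" for e
    using that permutes_in_image[OF cp(1)] by (auto simp: cp(3))
  then have "e \<subseteq> verts D" if "e \<in> edges C" for e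
    using that VD by (meson subset_trans)
  then have ED: "edges C \<subseteq> edges D"
    unfolding graph_component_edges[OF D(1)] using sub(2) by auto
  have finD: "finite (verts D)"
    using finite_simple_graphD(1)[OF finite_simple_graph_component[OF U D(1)]] .
  have "\<not> is_single_edge D"
    using card_mono[OF finD VD] is_cycle_card(2)[OF cyc] by (auto simp: is_single_edge_def)
  then have cycD: "is_cycle D" using sachs D(1) by (auto simp: sachs_graph_def)
  then have "C = D" by (rule cycle_subgraph_of_cycle[OF cyc _ VD ED])
  then show "C \<in> {C \<in> graph_components U. is_cycle C}" using D(1) cycD by simp
qed

section \<open>Covering sums of single edges and cycles\<close>

lemma covering_sum_single_edge:
  assumes "u \<noteq> w"
  shows "covering_sum s ({u, w}, {{u, w}}) = s u w * s w u"
  using assms by (simp add: covering_sum_def single_edge_covering_perms)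

text \<open>The only covering permutations are \<open>c\<close> and its inverse, which differ since
  no vertex returns after two steps. Reindexing the second product along \<open>c\<close> replaces
  the inverse by swapped arguments of \<open>s\<close>.\<close>

lemma covering_sum_transitive:
  assumes c: "c \<in> covering_perms C" "transitive_perm c (verts C)"
    and cc: "\<And>u. u \<in> verts C \<Longrightarrow> c (c u) \<noteq> u"
  shows "covering_sum s C = (\<Prod>u\<in>verts C. s u (c u)) + (\<Prod>u\<in>verts C. s (c u) u)"
proof -
  note cp = covering_permsD[OF c(1)]
  note ci = permutes_inverses[OF cp(1)]
  obtain x where "x \<in> verts C" using c(2) by (auto simp: transitive_perm_def)
  then have neq: "c \<noteq> Hilbert_Choice.inv c" using cc ci by metis
  have cov: "covering_perms C = {c, Hilbert_Choice.inv c}"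
    by (rule covering_perms_transitive[OF c]) (rule cc)
  have "covering_sum s C =
      (\<Prod>u\<in>verts C. s u (c u)) + (\<Prod>u\<in>verts C. s u (Hilbert_Choice.inv c u))"
    unfolding covering_sum_def cov using neq by simp
  also have "(\<Prod>u\<in>verts C. s u (Hilbert_Choice.inv c u)) = (\<Prod>u\<in>verts C. s (c u) u)"
    by (subst prod.permute[OF cp(1)]) (simp add: ci)
  finally show ?thesis .
qed

section \<open>Skew weights\<close>

text \<open>The matrix entry indexed by vertices, so that the combinatorics does not depend on the
  numbering \<open>v\<close>.\<close>

definition skew_entry :: "'a rel \<Rightarrow> ('a \<times> 'a \<Rightarrow> real) \<Rightarrow> 'a \<Rightarrow> 'a \<Rightarrow> real" where
  "skew_entry A \<omega> u w =
     (if (u, w) \<in> A then \<omega> (u, w) else if (w, u) \<in> A then - \<omega> (w, u) else 0)"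

lemma orientation_of_arc:
  assumes "orientation_of A G" "(u, w) \<in> A"
  shows "{u, w} \<in> edges G"
proof -
  have "(\<lambda>(u, v). {u, v}) ` A = edges G" using assms(1) by (simp add: orientation_of_def bij_betw_def)
  then show ?thesis using imageI[OF assms(2), of "\<lambda>(u, v). {u, v}"] by simp
qed

lemma orientation_of_edge:
  assumes "orientation_of A G" "{u, w} \<in> edges G"
  shows "(u, w) \<in> A \<or> (w, u) \<in> A"
proof -
  have "(\<lambda>(u, v). {u, v}) ` A = edges G" using assms(1) by (simp add: orientation_of_def bij_betw_def)
  then have "{u, w} \<in> (\<lambda>(u, v). {u, v}) ` A" using assms(2) by simp
  then obtain x y where "(x, y) \<in> A" "{u, w} = {x, y}" by auto
  then show ?thesis by (auto simp: doubleton_eq_iff)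
qed

lemma orientation_of_unique_arc:
  assumes "orientation_of A G" "(u, w) \<in> A" "(x, y) \<in> A" "{u, w} = {x, y}"
  shows "x = u \<and> y = w"
proof -
  have "inj_on (\<lambda>(u, v). {u, v}) A" using assms(1) by (simp add: orientation_of_def bij_betw_def)
  from inj_onD[OF this _ assms(2,3)] assms(4) show ?thesis by simp
qed

text \<open>An edge carries a single arc, so opposite arcs would have to be equal and form a
  loop.\<close>

lemma orientation_of_antisym:
  assumes G: "finite_simple_graph G" and A: "orientation_of A G" and arc: "(u, w) \<in> A"
  shows "(w, u) \<notin> A"
proof
  assume "(w, u) \<in> A"
  then have "w = u" using orientation_of_unique_arc[OF A arc] by (simp add: insert_commute)
  then show False
    using finite_simple_graphD(3)[OF G orientation_of_arc[OF A arc]] by simp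
qed

text \<open>Injectivity of forgetting directions makes the definite description in
  \<open>edge_weight\<close> denote the arc.\<close>

lemma edge_weight_arc:
  assumes "orientation_of A G" "(u, w) \<in> A"
  shows "edge_weight A \<omega> {u, w} = \<omega> (u, w)"
proof -
  have "(THE a. a \<in> A \<and> {fst a, snd a} = {u, w}) = (u, w)"
    by (rule the_equality) (use orientation_of_unique_arc[OF assms] assms(2) in auto)
  then show ?thesis by (simp add: edge_weight_def)
qed

text \<open>Separates the sign, which depends on the direction, from the weight, which depends only
  on the edge.\<close>

lemma skew_entry_edge:
  assumes A: "orientation_of A G" and e: "{u, w} \<in> edges G"
  shows "skew_entry A \<omega> u w = (if (u, w) \<in> A then 1 else - 1) * edge_weight A \<omega> {u, w}"
proof (cases "(u, w) \<in> A")
  case True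
  then show ?thesis by (simp add: skew_entry_def edge_weight_arc[OF A])
next
  case False
  then have "(w, u) \<in> A" using orientation_of_edge[OF A e] by blast
  then have "edge_weight A \<omega> {u, w} = \<omega> (w, u)"
    using edge_weight_arc[OF A, of w u] by (simp add: insert_commute)
  then show ?thesis using False \<open>(w, u) \<in> A\<close> by (simp add: skew_entry_def)
qed

lemma skew_entry_non_edge:
  assumes "orientation_of A G" "{u, w} \<notin> edges G"
  shows "skew_entry A \<omega> u w = 0"
  using assms(2) orientation_of_arc[OF assms(1), of u w] orientation_of_arc[OF assms(1), of w u]
  by (auto simp: skew_entry_def insert_commute)

lemma skew_entry_antisym:
  assumes "finite_simple_graph G" "orientation_of A G"
  shows "skew_entry A \<omega> w u = - skew_entry A \<omega> u w"
  using orientation_of_antisym[OF assms, of u w] orientation_of_antisym[OF assms, of w u]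
  by (auto simp: skew_entry_def)

lemma finite_simple_subgraph:
  assumes "finite_simple_graph G" "subgraph_of U G"
  shows "finite_simple_graph U"
proof -
  have "finite (verts U)"
    using assms finite_subset by (auto simp: finite_simple_graph_def subgraph_of_def)
  then show ?thesis using assms by (auto simp: finite_simple_graph_def subgraph_of_def)
qed

section \<open>Parity of the number of forward arcs around a cycle\<close>

lemma covering_perm_inj_edges:
  assumes c: "c \<in> covering_perms C" and cc: "\<And>u. u \<in> verts C \<Longrightarrow> c (c u) \<noteq> u"
  shows "inj_on (\<lambda>u. {u, c u}) (verts C)"
proof (rule inj_onI)
  fix u w assume "u \<in> verts C" "w \<in> verts C" "{u, c u} = {w, c w}"
  then show "u = w" using cc by (metis doubleton_eq_iff)
qed

text \<open>For each \<open>u\<close>, exactly one of \<open>(u, c u)\<close> and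
  \<open>(c u, u)\<close> is an arc. Shifting by \<open>c\<close> matches the forward arcs of the
  inverse with the backward arcs of \<open>c\<close>.\<close>

lemma card_forward_arcs_inv:
  assumes G: "finite_simple_graph G" and A: "orientation_of A G"
    and fin: "finite (verts C)" and sub: "edges C \<subseteq> edges G"
    and c: "c \<in> covering_perms C"
  shows "card {u \<in> verts C. (u, Hilbert_Choice.inv c u) \<in> A} +
    card {u \<in> verts C. (u, c u) \<in> A} = card (verts C)"
proof -
  note cp = covering_permsD[OF c]
  note ci = permutes_inverses[OF cp(1)]
  have rev: "(c u, u) \<in> A \<longleftrightarrow> (u, c u) \<notin> A" if "u \<in> verts C" for u
  proof -
    have "{u, c u} \<in> edges G" using that cp(3) sub by auto
    then show ?thesis
      using orientation_of_edge[OF A] orientation_of_antisym[OF G A] by blast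
  qed
  have "{u \<in> verts C. (u, Hilbert_Choice.inv c u) \<in> A} = c ` {u \<in> verts C. (c u, u) \<in> A}"
  proof (intro equalityI subsetI)
    fix u assume u: "u \<in> {u \<in> verts C. (u, Hilbert_Choice.inv c u) \<in> A}"
    then have "Hilbert_Choice.inv c u \<in> {u \<in> verts C. (c u, u) \<in> A}"
      by (simp add: ci permutes_in_image[OF permutes_inv[OF cp(1)]])
    then show "u \<in> c ` {u \<in> verts C. (c u, u) \<in> A}"
      by (intro image_eqI[where x = "Hilbert_Choice.inv c u"]) (simp_all add: ci)
  next
    fix u assume "u \<in> c ` {u \<in> verts C. (c u, u) \<in> A}"
    then show "u \<in> {u \<in> verts C. (u, Hilbert_Choice.inv c u) \<in> A}"
      by (auto simp: ci permutes_in_image[OF cp(1)])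
  qed
  then have "card {u \<in> verts C. (u, Hilbert_Choice.inv c u) \<in> A} = card {u \<in> verts C. (c u, u) \<in> A}"
    by (simp add: card_image permutes_inj_on[OF cp(1)])
  also have "{u \<in> verts C. (c u, u) \<in> A} = verts C - {u \<in> verts C. (u, c u) \<in> A}"
    using rev by auto
  also have "card \<dots> = card (verts C) - card {u \<in> verts C. (u, c u) \<in> A}"
    by (rule card_Diff_subset) (use fin in auto)
  finally show ?thesis
    using card_mono[OF fin, of "{u \<in> verts C. (u, c u) \<in> A}"] by auto
qed

text \<open>Carries the count in \<open>oddly_oriented\<close> from list positions over to
  vertices.\<close>

lemma card_forward_arcs_traverses:
  assumes "traverses xs C"
  shows "card {i. i < length xs \<and> (xs ! i, xs ! (Suc i mod length xs)) \<in> A} =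
    card {u \<in> verts C. (u, cycle_of_list xs u) \<in> A}"
proof (rule bij_betw_same_card[of "nth xs"])
  have d: "distinct xs" using assms unfolding traverses_def by blast
  show "bij_betw ((!) xs) {i. i < length xs \<and> (xs ! i, xs ! (Suc i mod length xs)) \<in> A}
      {u \<in> verts C. (u, cycle_of_list xs u) \<in> A}"
    unfolding bij_betw_def traverses_verts[OF assms]
  proof
    show "inj_on ((!) xs) {i. i < length xs \<and> (xs ! i, xs ! (Suc i mod length xs)) \<in> A}"
      by (rule inj_on_nth[OF d]) simp
    show "(!) xs ` {i. i < length xs \<and> (xs ! i, xs ! (Suc i mod length xs)) \<in> A} =
        {u \<in> set xs. (u, cycle_of_list xs u) \<in> A}"
      by (auto simp: in_set_conv_nth cycle_of_list_nth[OF d])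
  qed
qed

lemma odd_iff_of_even_add: "even (m + n) \<Longrightarrow> odd m \<longleftrightarrow> odd n" for m n :: nat
  by simp

text \<open>Each traversal induces \<open>c\<close> or its inverse, and their forward counts add up
  to the even length, so they have equal parity. A traversal exists, so the universal quantifier in
  \<open>oddly_oriented\<close> is not vacuous.\<close>

lemma oddly_oriented_iff:
  assumes G: "finite_simple_graph G" and A: "orientation_of A G"
    and fin: "finite (verts C)" and ev: "even (card (verts C))" and sub: "edges C \<subseteq> edges G"
    and c: "c \<in> covering_perms C" "transitive_perm c (verts C)"
    and cc: "\<And>u. u \<in> verts C \<Longrightarrow> c (c u) \<noteq> u"
  shows "oddly_oriented A C \<longleftrightarrow> odd (card {u \<in> verts C. (u, c u) \<in> A})"
proof -
  have cov: "covering_perms C = {c, Hilbert_Choice.inv c}"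
    by (rule covering_perms_transitive[OF c]) (rule cc)
  have inv_parity: "odd (card {u \<in> verts C. (u, Hilbert_Choice.inv c u) \<in> A}) \<longleftrightarrow>
      odd (card {u \<in> verts C. (u, c u) \<in> A})"
    by (rule odd_iff_of_even_add) (simp add: card_forward_arcs_inv[OF G A fin sub c(1)] ev)
  have parity: "odd (card {i. i < length xs \<and> (xs ! i, xs ! (Suc i mod length xs)) \<in> A}) \<longleftrightarrow>
      odd (card {u \<in> verts C. (u, c u) \<in> A})" if xs: "traverses xs C" for xs
    using traverses_covering_perm(1)[OF xs] inv_parity
    unfolding card_forward_arcs_traverses[OF xs] cov by auto
  have "is_cycle C" by (rule is_cycle_covering_perm[OF fin c]) (rule cc)
  then obtain xs where "traverses xs C" by (auto simp: is_cycle_def)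
  then show ?thesis unfolding oddly_oriented_def using parity by blast
qed

text \<open>Turns a power with a counting exponent into a product over the index set, to be merged
  with other products factor by factor.\<close>

lemma power_card_filter:
  fixes x :: "'b :: comm_monoid_mult"
  assumes "finite K"
  shows "x ^ card {i \<in> K. P i} = (\<Prod>i\<in>K. if P i then x else 1)"
  using prod.inter_filter[OF assms, of "\<lambda>_. x" P] by simp

text \<open>By skew symmetry, reversing the rotation multiplies its term by \<open>-1\<close> once
  per vertex. The two rotations therefore cancel for odd length and agree for even length.\<close>

lemma covering_sum_skew_cycle:
  assumes G: "finite_simple_graph G" and A: "orientation_of A G"
    and cyc: "is_cycle C" and sub: "edges C \<subseteq> edges G"
  shows "covering_sum (skew_entry A \<omega>) C =
    (if even (card (edges C))
     then (if oddly_oriented A C then - 1 else 1) * 2 * (\<Prod>e\<in>edges C. edge_weight A \<omega> e)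
     else 0)"
proof -
  obtain c where c: "c \<in> covering_perms C" "transitive_perm c (verts C)"
    and cc: "\<And>u. u \<in> verts C \<Longrightarrow> c (c u) \<noteq> u"
    using is_cycleE[OF cyc] by blast
  note cp = covering_permsD[OF c(1)]
  have fin: "finite (verts C)" using is_cycle_card(1)[OF cyc] .
  let ?s = "skew_entry A \<omega>"
  have inj: "inj_on (\<lambda>u. {u, c u}) (verts C)"
    by (rule covering_perm_inj_edges[OF c(1)]) (rule cc)
  have card: "card (edges C) = card (verts C)" unfolding cp(3) by (rule card_image[OF inj])
  have "covering_sum ?s C = (\<Prod>u\<in>verts C. ?s u (c u)) + (\<Prod>u\<in>verts C. ?s (c u) u)"
    by (rule covering_sum_transitive[OF c]) (rule cc)
  also have "(\<Prod>u\<in>verts C. ?s (c u) u) = (\<Prod>u\<in>verts C. (- 1) * ?s u (c u))"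
    by (intro prod.cong refl) (simp, rule skew_entry_antisym[OF G A])
  also have "\<dots> = (- 1) ^ card (verts C) * (\<Prod>u\<in>verts C. ?s u (c u))"
    by (simp only: prod.distrib prod_constant)
  finally have sum: "covering_sum ?s C =
      (1 + (- 1) ^ card (verts C)) * (\<Prod>u\<in>verts C. ?s u (c u))"
    by (simp add: algebra_simps)
  show ?thesis
  proof (cases "even (card (verts C))")
    case True
    \<comment> \<open>The minus signs come from the backward arcs \<open>?B\<close>, whereas
      \<open>oddly_oriented\<close> counts the forward arcs \<open>?F\<close>; at even length the
      two parities agree.\<close>
    let ?F = "{u \<in> verts C. (u, c u) \<in> A}" and ?B = "{u \<in> verts C. (u, c u) \<notin> A}"
    have "?F \<union> ?B = verts C" "?F \<inter> ?B = {}" by auto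
    then have "card (verts C) = card ?F + card ?B"
      using card_Un_disjoint[of ?F ?B] fin by simp
    then have par: "odd (card ?F) \<longleftrightarrow> odd (card ?B)"
      using True by (intro odd_iff_of_even_add) simp
    have "(\<Prod>u\<in>verts C. ?s u (c u)) =
        (\<Prod>u\<in>verts C. (if (u, c u) \<notin> A then - 1 else 1) * edge_weight A \<omega> {u, c u})"
    proof (rule prod.cong)
      fix u assume "u \<in> verts C"
      then have "{u, c u} \<in> edges G" using cp(3) sub by auto
      then show "?s u (c u) = (if (u, c u) \<notin> A then - 1 else 1) * edge_weight A \<omega> {u, c u}"
        by (simp add: skew_entry_edge[OF A])
    qed simp
    also have "\<dots> = (- 1) ^ card ?B * (\<Prod>u\<in>verts C. edge_weight A \<omega> {u, c u})"
      by (simp only: prod.distrib power_card_filter[OF fin])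
    also have "(\<Prod>u\<in>verts C. edge_weight A \<omega> {u, c u}) = (\<Prod>e\<in>edges C. edge_weight A \<omega> e)"
      unfolding cp(3) by (simp add: prod.reindex[OF inj])
    also have "(- 1 :: real) ^ card ?B = (if oddly_oriented A C then - 1 else 1)"
      using oddly_oriented_iff[OF G A fin True sub c] cc par by (auto simp: minus_one_power_iff)
    finally show ?thesis using sum card True by simp
  next
    case False
    then show ?thesis using sum card by simp
  qed
qed

text \<open>Only the transposition covers a single edge, and its two entries are opposite.\<close>

lemma covering_sum_skew_single_edge:
  assumes G: "finite_simple_graph G" and A: "orientation_of A G"
    and C: "is_single_edge C" and sub: "edges C \<subseteq> edges G"
  shows "covering_sum (skew_entry A \<omega>) C = - (\<Prod>e\<in>edges C. (edge_weight A \<omega> e)\<^sup>2)"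
proof -
  obtain u w where uw: "u \<noteq> w" "C = ({u, w}, {{u, w}})"
    using C by (auto simp: is_single_edge_def)
  have "covering_sum (skew_entry A \<omega>) C = skew_entry A \<omega> u w * skew_entry A \<omega> w u"
    unfolding uw(2) by (rule covering_sum_single_edge[OF uw(1)])
  also have "\<dots> = - (skew_entry A \<omega> u w)\<^sup>2"
    unfolding skew_entry_antisym[OF G A, of \<omega> w u] by (simp add: power2_eq_square)
  also have "(skew_entry A \<omega> u w)\<^sup>2 = (edge_weight A \<omega> {u, w})\<^sup>2"
    using sub uw(2) by (simp add: skew_entry_edge[OF A])
  finally show ?thesis using uw(2) by simp
qed

section \<open>The summand of the theorem and its factorization over components\<close>

definition sachs_weight :: "'a rel \<Rightarrow> ('a \<times> 'a \<Rightarrow> real) \<Rightarrow> 'a ugraph \<Rightarrow> real" where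
  "sachs_weight A \<omega> U =
     (-1) ^ (num_single_edges U + num_odd_cycles A U) * 2 ^ num_cycles U * weight_product A \<omega> U"

text \<open>In a Sachs graph the cycles are the cyclic components and all other components are
  single edges. So each exponent counts components, and \<open>edge_mult\<close> is constant on a
  component.\<close>

lemma sachs_weight_components:
  assumes U: "finite_simple_graph U" and sachs: "sachs_graph U"
  shows "sachs_weight A \<omega> U = (\<Prod>C\<in>graph_components U.
    if is_cycle C
    then (if oddly_oriented A C then - 1 else 1) * 2 * (\<Prod>e\<in>edges C. edge_weight A \<omega> e)
    else - (\<Prod>e\<in>edges C. (edge_weight A \<omega> e)\<^sup>2))"
proof -
  let ?K = "graph_components U"
  note UD = finite_simple_graphD[OF U]
  note cycles = cycles_of_sachs_graph[OF U sachs]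
  have finK: "finite ?K" using UD(1) by (rule finite_graph_components)
  have "{C \<in> ?K. is_single_edge C} = {C \<in> ?K. \<not> is_cycle C}"
    using sachs is_single_edge_not_cycle unfolding sachs_graph_def by blast
  then have single: "(- 1 :: real) ^ num_single_edges U = (\<Prod>C\<in>?K. if \<not> is_cycle C then - 1 else 1)"
    unfolding num_single_edges_def by (simp only: power_card_filter[OF finK])
  have "{C \<in> cycles_of U. oddly_oriented A C} = {C \<in> ?K. is_cycle C \<and> oddly_oriented A C}"
    unfolding cycles by blast
  then have odd: "(- 1 :: real) ^ num_odd_cycles A U =
      (\<Prod>C\<in>?K. if is_cycle C \<and> oddly_oriented A C then - 1 else 1)"
    unfolding num_odd_cycles_def by (simp only: power_card_filter[OF finK])
  have two: "(2 :: real) ^ num_cycles U = (\<Prod>C\<in>?K. if is_cycle C then 2 else 1)"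
    unfolding num_cycles_def cycles by (simp only: power_card_filter[OF finK])
  \<comment> \<open>Components share no edges, so an edge lies on a cycle of \<open>U\<close>
    exactly when its own component is that cycle.\<close>
  have mult: "edge_mult U e = (if is_cycle C then 1 else 2)" if "C \<in> ?K" "e \<in> edges C" for C e
  proof -
    have "(\<exists>D\<in>cycles_of U. e \<in> edges D) \<longleftrightarrow> is_cycle C"
      unfolding cycles using that components_edges_disjoint[OF U that(1)] by blast
    then show ?thesis by (simp add: edge_mult_def)
  qed
  have "weight_product A \<omega> U = (\<Prod>C\<in>?K. \<Prod>e\<in>edges C. edge_weight A \<omega> e ^ edge_mult U e)"
    unfolding weight_product_def
  proof (subst edges_eq_Union_components[OF U], rule prod.UNION_disjoint)
    show "\<forall>C\<in>?K. finite (edges C)"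
      using finite_simple_graphD(4)[OF finite_simple_graph_component[OF U]] by blast
  qed (use finK components_edges_disjoint[OF U] in blast)+
  also have "\<dots> = (\<Prod>C\<in>?K. \<Prod>e\<in>edges C. edge_weight A \<omega> e ^ (if is_cycle C then 1 else 2))"
    by (intro prod.cong refl) (simp add: mult)
  finally show ?thesis
    unfolding sachs_weight_def power_add single odd two
    by (simp only: prod.distrib[symmetric]) (rule prod.cong, auto)
qed

text \<open>Both quantities factor over components and agree factor by factor; one odd cycle
  contributes the factor zero.\<close>

lemma covering_sum_skew:
  assumes G: "finite_simple_graph G" and A: "orientation_of A G"
    and sub: "subgraph_of U G" and sachs: "sachs_graph U"
  shows "covering_sum (skew_entry A \<omega>) U =
    (if \<forall>C\<in>cycles_of U. even (card (edges C)) then sachs_weight A \<omega> U else 0)"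
proof -
  let ?K = "graph_components U"
  have U: "finite_simple_graph U" using finite_simple_subgraph[OF G sub] .
  have finK: "finite ?K" using finite_simple_graphD(1)[OF U] by (rule finite_graph_components)
  have edges: "edges C \<subseteq> edges G" if "C \<in> ?K" for C
    using graph_component_edges[OF that] sub by (auto simp: subgraph_of_def)
  note cycle = covering_sum_skew_cycle[OF G A _ edges]
  show ?thesis
  proof (cases "\<forall>C\<in>cycles_of U. even (card (edges C))")
    case True
    have "covering_sum (skew_entry A \<omega>) U = sachs_weight A \<omega> U"
      unfolding covering_sum_components[OF U] sachs_weight_components[OF U sachs]
    proof (rule prod.cong)
      fix C assume C: "C \<in> ?K"
      show "covering_sum (skew_entry A \<omega>) C = (if is_cycle C
          then (if oddly_oriented A C then - 1 else 1) * 2 * (\<Prod>e\<in>edges C. edge_weight A \<omega> e)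
          else - (\<Prod>e\<in>edges C. (edge_weight A \<omega> e)\<^sup>2))"
      proof (cases "is_cycle C")
        case cyc: True
        then have "even (card (edges C))"
          using True C cycles_of_sachs_graph[OF U sachs] by blast
        then show ?thesis using cycle[OF cyc C] cyc by simp
      next
        case False
        then have "is_single_edge C" using sachs C by (auto simp: sachs_graph_def)
        then show ?thesis
          using covering_sum_skew_single_edge[OF G A _ edges[OF C]] False by simp
      qed
    qed simp
    then show ?thesis using True by simp
  next
    case False
    then obtain C where C: "C \<in> ?K" "is_cycle C" "odd (card (edges C))"
      using cycles_of_sachs_graph[OF U sachs] by blast
    then have "covering_sum (skew_entry A \<omega>) C = 0" using cycle[OF C(2,1)] by simp
    then have "covering_sum (skew_entry A \<omega>) U = 0"
      unfolding covering_sum_components[OF U] using prod_zero[OF finK] C(1) by blast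
    then show ?thesis by (simp only: if_not_P[OF False])
  qed
qed

section \<open>The permanental polynomial\<close>

text \<open>The fixed points in \<open>V\<close> pick the diagonal entries of
  \<open>x I - A\<close>, so the number of moved points is the index of the coefficient a
  permutation contributes to.\<close>

definition moved :: "'a set \<Rightarrow> ('a \<Rightarrow> 'a) \<Rightarrow> 'a set" where
  "moved V p = {u \<in> V. p u \<noteq> u}"

lemma moved_subset: "moved V p \<subseteq> V"
  by (auto simp: moved_def)

lemma permutes_moved:
  assumes "p permutes V"
  shows "p permutes moved V p"
  using assms by (rule permutes_superset) (simp add: moved_def)

text \<open>Terms that use a non-edge vanish. The remaining permutations are grouped by their
  functional graph \<open>gr p\<close>; the group of a Sachs subgraph \<open>U\<close> is all of
  \<open>covering_perms U\<close> and sums to \<open>covering_sum\<close>, which is zero if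
  \<open>U\<close> has an odd cycle.\<close>

lemma sum_moved_eq_sum_sachs:
  assumes G: "finite_simple_graph G" and A: "orientation_of A G"
  shows "(\<Sum>p | p permutes verts G \<and> card (moved (verts G) p) = k.
      \<Prod>u\<in>moved (verts G) p. skew_entry A \<omega> u (p u)) =
    (\<Sum>U\<in>even_sachs_subgraphs G k. sachs_weight A \<omega> U)"
proof -
  let ?V = "verts G" and ?s = "skew_entry A \<omega>"
  note GD = finite_simple_graphD[OF G]
  define S where "S = {p. p permutes ?V \<and> card (moved ?V p) = k \<and>
    (\<forall>u\<in>moved ?V p. {u, p u} \<in> edges G)}"
  define T where "T = {U. subgraph_of U G \<and> sachs_graph U \<and> card (verts U) = k}"
  define gr where "gr p = (moved ?V p, (\<lambda>u. {u, p u}) ` moved ?V p)" for p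
  have finP: "finite {p. p permutes ?V \<and> card (moved ?V p) = k}"
    by (rule finite_subset[OF _ finite_permutations[OF GD(1)]]) auto
  have finS: "finite S"
    by (rule finite_subset[OF _ finP]) (auto simp: S_def)
  have "T \<subseteq> Pow ?V \<times> Pow (edges G)" by (auto simp: T_def subgraph_of_def)
  then have finT: "finite T" by (rule finite_subset) (use GD(1,4) in auto)
  have gr_cov: "p \<in> covering_perms (gr p)" and gr_sub: "subgraph_of (gr p) G"
    and gr_card: "card (verts (gr p)) = k" if "p \<in> S" for p
  proof -
    have p: "p permutes moved ?V p" using that permutes_moved unfolding S_def by blast
    then show "p \<in> covering_perms (gr p)" by (simp add: covering_perms_def gr_def moved_def)
    show "subgraph_of (gr p) G"
      using that moved_subset[of ?V p]
      by (auto simp: subgraph_of_def gr_def S_def permutes_in_image[OF p])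
    show "card (verts (gr p)) = k" using that by (simp add: S_def gr_def)
  qed
  have "gr ` S \<subseteq> T"
    using gr_sub gr_card covering_perms_sachs[OF finite_simple_subgraph[OF G gr_sub] gr_cov]
    by (auto simp: T_def)
  \<comment> \<open>A covering permutation of \<open>U\<close> moves precisely the vertices of
    \<open>U\<close>, so \<open>gr\<close> recovers \<open>U\<close> from it.\<close>
  have fiber: "{p \<in> S. gr p = U} = covering_perms U" if U: "U \<in> T" for U
  proof (intro equalityI subsetI)
    fix p assume "p \<in> {p \<in> S. gr p = U}"
    then show "p \<in> covering_perms U" using gr_cov by blast
  next
    fix p assume p: "p \<in> covering_perms U"
    note pp = covering_permsD[OF p]
    have sub: "verts U \<subseteq> ?V" "edges U \<subseteq> edges G" "card (verts U) = k"
      using U by (auto simp: T_def subgraph_of_def)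
    have mv: "moved ?V p = verts U"
      using pp(2) sub(1) permutes_not_in[OF pp(1)] by (auto simp: moved_def)
    then have "gr p = U" using pp(3) by (simp add: gr_def prod_eq_iff)
    moreover have "p \<in> S"
      using permutes_subset[OF pp(1) sub(1)] sub(2,3) pp(3) by (auto simp: S_def mv)
    ultimately show "p \<in> {p \<in> S. gr p = U}" by simp
  qed
  have "(\<Sum>p | p permutes ?V \<and> card (moved ?V p) = k. \<Prod>u\<in>moved ?V p. ?s u (p u)) =
      (\<Sum>p\<in>S. \<Prod>u\<in>moved ?V p. ?s u (p u))"
  proof (rule sum.mono_neutral_right[OF finP])
    show "\<forall>p\<in>{p. p permutes ?V \<and> card (moved ?V p) = k} - S. (\<Prod>u\<in>moved ?V p. ?s u (p u)) = 0"
    proof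
      fix p assume "p \<in> {p. p permutes ?V \<and> card (moved ?V p) = k} - S"
      then obtain u where u: "u \<in> moved ?V p" "{u, p u} \<notin> edges G" by (auto simp: S_def)
      have "finite (moved ?V p)" using moved_subset GD(1) by (rule finite_subset)
      then show "(\<Prod>u\<in>moved ?V p. ?s u (p u)) = 0"
        by (intro prod_zero bexI[OF _ u(1)] skew_entry_non_edge[OF A u(2)])
    qed
  qed (auto simp: S_def)
  also have "\<dots> = (\<Sum>U\<in>T. \<Sum>p\<in>{p \<in> S. gr p = U}. \<Prod>u\<in>moved ?V p. ?s u (p u))"
    by (rule sum.group[symmetric]) fact+
  also have "\<dots> = (\<Sum>U\<in>T. covering_sum ?s U)"
  proof (rule sum.cong)
    fix U assume U: "U \<in> T"
    have "(\<Prod>u\<in>moved ?V p. ?s u (p u)) = (\<Prod>u\<in>verts U. ?s u (p u))" if "gr p = U" for p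
      unfolding that[symmetric] gr_def by simp
    then show "(\<Sum>p\<in>{p \<in> S. gr p = U}. \<Prod>u\<in>moved ?V p. ?s u (p u)) = covering_sum ?s U"
      unfolding covering_sum_def fiber[OF U, symmetric] by (intro sum.cong) auto
  qed simp
  also have "\<dots> = (\<Sum>U\<in>T. if \<forall>C\<in>cycles_of U. even (card (edges C)) then sachs_weight A \<omega> U else 0)"
    by (rule sum.cong) (auto simp only: T_def covering_sum_skew[OF G A])
  also have "\<dots> = (\<Sum>U\<in>{U \<in> T. \<forall>C\<in>cycles_of U. even (card (edges C))}. sachs_weight A \<omega> U)"
    by (rule sum.inter_filter[OF finT, symmetric])
  also have "{U \<in> T. \<forall>C\<in>cycles_of U. even (card (edges C))} = even_sachs_subgraphs G k"
    unfolding T_def even_sachs_subgraphs_def by blast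
  finally show ?thesis .
qed

text \<open>Pairing \<open>p\<close> with its inverse transposes the matrix, so skew symmetry gives
  the total the sign \<open>(-1)\<^sup>k\<close>.\<close>

lemma sum_moved_odd:
  fixes s :: "'a \<Rightarrow> 'a \<Rightarrow> real"
  assumes antisym: "\<And>u w. s w u = - s u w" and k: "odd k"
  shows "(\<Sum>p | p permutes V \<and> card (moved V p) = k. \<Prod>u\<in>moved V p. s u (p u)) = 0"
proof -
  let ?P = "{p. p permutes V \<and> card (moved V p) = k}"
  let ?f = "\<lambda>p. \<Prod>u\<in>moved V p. s u (p u)"
  have moved_inv: "moved V (Hilbert_Choice.inv p) = moved V p" if "p permutes V" for p
    using permutes_inverses[OF that] by (auto simp: moved_def) metis+
  have "?f (Hilbert_Choice.inv p) = - ?f p" if p: "p \<in> ?P" for p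
  proof -
    have pV: "p permutes V" and card: "card (moved V p) = k" using p by auto
    have "?f (Hilbert_Choice.inv p) = (\<Prod>u\<in>moved V p. s u (Hilbert_Choice.inv p u))"
      by (simp add: moved_inv[OF pV])
    also have "\<dots> = (\<Prod>u\<in>moved V p. s (p u) u)"
      by (subst prod.permute[OF permutes_moved[OF pV]]) (simp add: permutes_inverses[OF pV])
    also have "\<dots> = (\<Prod>u\<in>moved V p. (- 1) * s u (p u))"
      by (intro prod.cong refl) (simp, rule antisym)
    also have "\<dots> = (- 1) ^ card (moved V p) * ?f p"
      by (simp only: prod.distrib prod_constant)
    finally show ?thesis using card k by simp
  qed
  moreover have "sum ?f ?P = (\<Sum>p\<in>?P. ?f (Hilbert_Choice.inv p))"
    by (rule sum.reindex_bij_witness[where i = Hilbert_Choice.inv and j = Hilbert_Choice.inv])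
      (auto simp: permutes_inv permutes_inv_inv moved_inv)
  ultimately have "sum ?f ?P = - sum ?f ?P" by (simp add: sum_negf)
  then show ?thesis by simp
qed

section \<open>Permanents as sums over vertex permutations\<close>

lemma permanent_reindex:
  assumes v: "bij_betw v {..<n} V"
  shows "permanent (mat n n (\<lambda>(i, j). f (v i) (v j))) = (\<Sum>p | p permutes V. \<Prod>u\<in>V. f u (p u))"
proof -
  \<comment> \<open>Conjugation by \<open>v\<close>, extended by the identity outside
    \<open>V\<close>; the form is that of \<open>bij_betw_permutations\<close>.\<close>
  let ?h = "\<lambda>\<pi> x. if x \<in> V then v (\<pi> (inv_into {..<n} v x)) else x"
  have "(\<Sum>p | p permutes V. \<Prod>u\<in>V. f u (p u)) =
      (\<Sum>\<pi> | \<pi> permutes {..<n}. \<Prod>u\<in>V. f u (?h \<pi> u))"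
    by (rule sum.reindex_bij_betw[OF bij_betw_permutations[OF v], symmetric])
  also have "\<dots> = (\<Sum>\<pi> | \<pi> permutes {..<n}. \<Prod>i<n. f (v i) (v (\<pi> i)))"
  proof (rule sum.cong)
    fix \<pi> assume "\<pi> \<in> {\<pi>. \<pi> permutes {..<n}}"
    have "(\<Prod>u\<in>V. f u (?h \<pi> u)) = (\<Prod>i<n. f (v i) (?h \<pi> (v i)))"
      by (rule prod.reindex_bij_betw[OF v, symmetric])
    also have "\<dots> = (\<Prod>i<n. f (v i) (v (\<pi> i)))"
      using bij_betwE[OF v] bij_betw_inv_into_left[OF v] by (intro prod.cong) auto
    finally show "(\<Prod>u\<in>V. f u (?h \<pi> u)) = (\<Prod>i<n. f (v i) (v (\<pi> i)))" .
  qed simp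
  also have "\<dots> = permanent (mat n n (\<lambda>(i, j). f (v i) (v j)))"
    unfolding permanent_def
  proof (rule sum.cong)
    fix \<pi> assume "\<pi> \<in> {p. p permutes {0..<dim_row (mat n n (\<lambda>(i, j). f (v i) (v j)))}}"
    then have "\<pi> permutes {0..<n}" by simp
    then have "\<pi> i < n" if "i < n" for i
      using that permutes_in_image[of \<pi> "{0..<n}" i] by simp
    then show "(\<Prod>i<n. f (v i) (v (\<pi> i))) =
        (\<Prod>i = 0..<dim_row (mat n n (\<lambda>(i, j). f (v i) (v j))).
          mat n n (\<lambda>(i, j). f (v i) (v j)) $$ (i, \<pi> i))"
      by (intro prod.cong) (auto simp: atLeast0LessThan)
  qed (simp add: atLeast0LessThan)
  finally show ?thesis ..
qed

lemma skew_adj_mat_eq: "skew_adj_mat n v A \<omega> = mat n n (\<lambda>(i, j). skew_entry A \<omega> (v i) (v j))"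
  by (simp add: skew_adj_mat_def skew_entry_def)

text \<open>The diagonal of the skew matrix is zero, so each fixed point contributes exactly the
  variable and each moved point a constant. Every permutation thus yields a single monomial.\<close>

lemma permanental_poly_skew_adj_mat:
  assumes G: "finite_simple_graph G" and v: "bij_betw v {..<n} (verts G)"
    and A: "orientation_of A G"
  shows "permanental_poly (skew_adj_mat n v A \<omega>) = (\<Sum>p | p permutes verts G.
    monom (\<Prod>u\<in>moved (verts G) p. - skew_entry A \<omega> u (p u)) (n - card (moved (verts G) p)))"
proof -
  let ?V = "verts G" and ?s = "skew_entry A \<omega>"
  note GD = finite_simple_graphD[OF G]
  have card_V: "card ?V = n" using bij_betw_same_card[OF v] by simp
  have diag: "?s u u = 0" for u using skew_entry_antisym[OF G A, of \<omega> u u] by simp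
  have inj: "v i = v j \<longleftrightarrow> i = j" if "i < n" "j < n" for i j
    using bij_betw_imp_inj_on[OF v] that by (auto dest: inj_onD)
  \<comment> \<open>\<open>monom 1 1\<close> is the polynomial variable. Equality of vertices can
    replace equality of indices because \<open>v\<close> is injective.\<close>
  let ?f = "\<lambda>u w. if u = w then monom 1 1 else [:- ?s u w:]"
  have "char_poly_matrix (skew_adj_mat n v A \<omega>) = mat n n (\<lambda>(i, j). ?f (v i) (v j))"
    by (rule eq_matI) (auto simp: char_poly_matrix_def skew_adj_mat_eq inj diag monom_altdef)
  then have "permanental_poly (skew_adj_mat n v A \<omega>) = (\<Sum>p | p permutes ?V. \<Prod>u\<in>?V. ?f u (p u))"
    by (simp only: permanental_poly_def permanent_reindex[OF v, of ?f])
  also have "\<dots> = (\<Sum>p | p permutes ?V.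
      monom (\<Prod>u\<in>moved ?V p. - ?s u (p u)) (n - card (moved ?V p)))"
  proof (rule sum.cong)
    fix p
    have fin: "finite (moved ?V p)" using moved_subset GD(1) by (rule finite_subset)
    have "(\<Prod>u\<in>?V. ?f u (p u)) = (\<Prod>u\<in>?V - moved ?V p. ?f u (p u)) * (\<Prod>u\<in>moved ?V p. ?f u (p u))"
      by (rule prod.subset_diff[OF moved_subset GD(1)])
    also have "(\<Prod>u\<in>?V - moved ?V p. ?f u (p u)) = (\<Prod>u\<in>?V - moved ?V p. monom 1 1)"
      by (intro prod.cong) (auto simp: moved_def)
    also have "\<dots> = monom 1 (n - card (moved ?V p))"
      by (simp add: monom_power card_Diff_subset[OF fin moved_subset] card_V)
    also have "(\<Prod>u\<in>moved ?V p. ?f u (p u)) = (\<Prod>u\<in>moved ?V p. [:- ?s u (p u):])"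
      by (intro prod.cong) (auto simp: moved_def)
    also have "\<dots> = [:\<Prod>u\<in>moved ?V p. - ?s u (p u):]"
      by (induction rule: finite_induct[OF fin]) (simp_all add: one_pCons)
    finally show "(\<Prod>u\<in>?V. ?f u (p u)) =
        monom (\<Prod>u\<in>moved ?V p. - ?s u (p u)) (n - card (moved ?V p))"
      by (simp add: smult_monom mult.commute)
  qed simp
  finally show ?thesis .
qed

theorem theorem2p3:
  fixes G :: "'a ugraph" and A :: "'a rel" and \<omega> :: "'a \<times> 'a \<Rightarrow> real"
    and n :: nat and v :: "nat \<Rightarrow> 'a" and a :: "nat \<Rightarrow> real"
  assumes "finite_simple_graph G"
    and "bij_betw v {..<n} (verts G)"
    and "orientation_of A G"
    and a_def: "\<And>k. a k = coeff (permanental_poly (skew_adj_mat n v A \<omega>)) (n - k)"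
  shows "permanental_poly (skew_adj_mat n v A \<omega>) = (\<Sum>k\<le>n. monom (a k) (n - k)) \<and>
    (\<forall>k\<le>n. odd k \<longrightarrow> a k = 0) \<and>
    (\<forall>k\<le>n. even k \<longrightarrow>
       a k = (\<Sum>U\<in>even_sachs_subgraphs G k.
                (-1) ^ (num_single_edges U + num_odd_cycles A U) * 2 ^ num_cycles U
                  * weight_product A \<omega> U)) \<and>
    permanent (skew_adj_mat n v A \<omega>) =
      (\<Sum>U\<in>even_sachs_subgraphs G n.
         (-1) ^ (num_single_edges U + num_odd_cycles A U) * 2 ^ num_cycles U
           * weight_product A \<omega> U)"
proof -
  note G = assms(1) and v = assms(2) and A = assms(3)
  note GD = finite_simple_graphD[OF G]
  let ?V = "verts G" and ?s = "skew_entry A \<omega>"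
  let ?P = "permanental_poly (skew_adj_mat n v A \<omega>)"
  let ?T = "\<lambda>k. \<Sum>p | p permutes ?V \<and> card (moved ?V p) = k. \<Prod>u\<in>moved ?V p. ?s u (p u)"
  note P = permanental_poly_skew_adj_mat[OF G v A, of \<omega>]
  note antisym = skew_entry_antisym[OF G A]
  have finP: "finite {p. p permutes ?V}" using finite_permutations[OF GD(1)] .
  have card_V: "card ?V = n" using bij_betw_same_card[OF v] by simp
  have moved_le: "card (moved ?V p) \<le> n" for p
    using card_mono[OF GD(1) moved_subset] card_V by simp
  \<comment> \<open>The power of \<open>-1\<close> collects the signs of the \<open>k\<close>
    off-diagonal entries of \<open>x I - A\<close>.\<close>
  have a_eq: "a k = (- 1) ^ k * ?T k" if k: "k \<le> n" for k
  proof -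
    have "a k = (\<Sum>p | p permutes ?V.
        if card (moved ?V p) = k then \<Prod>u\<in>moved ?V p. - ?s u (p u) else 0)"
      unfolding a_def P coeff_sum coeff_monom
    proof (rule sum.cong)
      fix p
      \<comment> \<open>Both subtrahends are at most \<open>n\<close>, so truncated subtraction
        loses nothing.\<close>
      have "n - card (moved ?V p) = n - k \<longleftrightarrow> card (moved ?V p) = k"
        using moved_le[of p] k by linarith
      then show "(if n - card (moved ?V p) = n - k then \<Prod>u\<in>moved ?V p. - ?s u (p u) else 0) =
          (if card (moved ?V p) = k then \<Prod>u\<in>moved ?V p. - ?s u (p u) else 0)" by simp
    qed simp
    also have "\<dots> = (\<Sum>p | p permutes ?V \<and> card (moved ?V p) = k. \<Prod>u\<in>moved ?V p. - ?s u (p u))"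
      using sum.inter_filter[OF finP, symmetric] by simp
    also have "\<dots> = (\<Sum>p | p permutes ?V \<and> card (moved ?V p) = k.
        (- 1) ^ k * (\<Prod>u\<in>moved ?V p. ?s u (p u)))"
      by (rule sum.cong) (auto simp: prod_uminus)
    finally show ?thesis by (simp add: sum_distrib_left)
  qed
  \<comment> \<open>The degree bound lets the coefficients up to \<open>n\<close> determine the
    polynomial; reversing the index then gives the expansion in \<open>n - k\<close>.\<close>
  have "degree ?P \<le> n"
    unfolding P by (rule degree_sum_le[OF finP]) (meson degree_monom_le diff_le_self order_trans)
  then have "?P = (\<Sum>i\<le>n. monom (coeff ?P i) i)" by (rule poly_as_sum_of_monoms'[symmetric])
  also have "\<dots> = (\<Sum>k\<le>n. monom (a k) (n - k))"
    unfolding a_def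
    by (rule sum.reindex_bij_witness[where i = "\<lambda>k. n - k" and j = "\<lambda>k. n - k"]) auto
  finally have poly: "?P = (\<Sum>k\<le>n. monom (a k) (n - k))" .
  have odd: "a k = 0" if "k \<le> n" "odd k" for k
    using a_eq[OF that(1)] sum_moved_odd[of ?s k ?V, OF antisym that(2)] by simp
  have even: "a k = (\<Sum>U\<in>even_sachs_subgraphs G k. sachs_weight A \<omega> U)" if "k \<le> n" "even k" for k
    using a_eq[OF that(1)] that(2) sum_moved_eq_sum_sachs[OF G A] by simp
  \<comment> \<open>With a zero diagonal only permutations moving every vertex contribute, which
    gives \<open>?T n\<close> directly, without a sign and for \<open>n\<close> of either
    parity.\<close>
  have "permanent (skew_adj_mat n v A \<omega>) = (\<Sum>p | p permutes ?V. \<Prod>u\<in>?V. ?s u (p u))"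
    unfolding skew_adj_mat_eq by (rule permanent_reindex[OF v])
  also have "\<dots> = ?T n"
  proof (rule sum.mono_neutral_cong_right[OF finP])
    have eq_V: "moved ?V p = ?V" if "card (moved ?V p) = n" for p
      using card_subset_eq[OF GD(1) moved_subset] that card_V by simp
    show "\<forall>p\<in>{p. p permutes ?V} - {p. p permutes ?V \<and> card (moved ?V p) = n}.
        (\<Prod>u\<in>?V. ?s u (p u)) = 0"
    proof
      fix p assume "p \<in> {p. p permutes ?V} - {p. p permutes ?V \<and> card (moved ?V p) = n}"
      then have "moved ?V p \<noteq> ?V" using card_V by auto
      then obtain u where u: "u \<in> ?V" "p u = u" by (auto simp: moved_def)
      have "?s u (p u) = 0" using antisym[of \<omega> u u] u(2) by simp
      then show "(\<Prod>u\<in>?V. ?s u (p u)) = 0" by (intro prod_zero[OF GD(1)] bexI[OF _ u(1)])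
    qed
    show "(\<Prod>u\<in>?V. ?s u (p u)) = (\<Prod>u\<in>moved ?V p. ?s u (p u))"
      if "p \<in> {p. p permutes ?V \<and> card (moved ?V p) = n}" for p
      using eq_V[of p] that by simp
  qed auto
  finally have "permanent (skew_adj_mat n v A \<omega>) =
      (\<Sum>U\<in>even_sachs_subgraphs G n. sachs_weight A \<omega> U)"
    by (simp only: sum_moved_eq_sum_sachs[OF G A])
  then show ?thesis
    using poly odd even unfolding sachs_weight_def by blast
qed

end
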